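(* Let $n\geq 2$ and $m\leq n$ be positive integers. Then $$\chi\big(K_m^{M(M(K_n))}\big)=\mathrm{conn}\big(\mathcal{N}(K_m^{M(M(K_n))})\big)+3.$$ Moreover, $\mathcal{N}(K_m^{M(M(K_n))})$ is homotopy equivalent to $\mathbb{S}^{m-2}$.
   Context: All graphs are finite, undirected, without multiple edges; loops are allowed unless the graph is called simple (no loops). $E(G)\subseteq V(G)\times V(G)$ is the symmetric edge relation, and $x \sim y$ means $(x,y)\in E(G)$. $K_n$ is the complete graph on $\{1,\dots,n\}$ (no loops). The chromatic number $\chi(G)$ of a simple graph $G$ is the least $n$ such that there is a graph homomorphism (edge-preserving vertex map) $G\to K_n$. Categorical product: $G\times H$ has vertex set $V(G)\times V(H)$, with $(g,h)\sim(g',h')$ iff $g\sim g'$ in $G$ and $h\sim h'$ in $H$. Mycielskian: let $L_2(\{0\})$ be the graph with vertex set $\{0,1,2\}$, edges $0\sim1$, $1\sim2$ and a loop at $0$. For a graph $G$, the Mycielskian $M(G)$ is the quotient of $G\times L_2(\{0\})$ identifying all vertices with second coordinate $2$ to a single vertex (two vertices of the quotient are adjacent iff some representatives are adjacent). Exponential graph: $H^G$ has as vertices all set maps $V(G)\to V(H)$, and $f\sim f'$ in $H^G$ iff $v\sim v'$ in $G$ implies $f(v)\sim f'(v')$ in $H$. Neighborhood complex: $\mathcal{N}(G)$ is the simplicial complex whose simplices are the subsets $A\subseteq V(G)$ having a common neighbor (some $x$ with $(x,a)\in E(G)$ for all $a\in A$), regarded as a topological space via its geometric realization. A space $X$ is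 $k$-connected if for all $0\le j\le k$ every continuous map $\mathbb{S}^j\to X$ extends to the ball $\mathbb{B}^{j+1}$; $\mathrm{conn}(X)$ is the largest $k$ such that $X$ is $k$-connected, and it is $-1$ for a nonempty disconnected space. For $m=1$ the usual conventions $\mathbb{S}^{-1}=\emptyset$ and $\mathrm{conn}(\emptyset)=-2$ are used. *)

theory Defs
  imports "HOL-Analysis.Analysis" "Graph_Theory.Pair_Digraph"
begin

section \<open>Graphs\<close>

text \<open>A graph is a \<^typ>\<open>'a pair_pre_digraph\<close>: a set of vertices together with an adjacency
  relation on it. Loops are allowed. The definitions below are meant for finite graphs with a
  symmetric adjacency relation.\<close>

definition graph_hom :: "('a \<Rightarrow> 'b) \<Rightarrow> 'a pair_pre_digraph \<Rightarrow> 'b pair_pre_digraph \<Rightarrow> bool" where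
  "graph_hom h G H \<longleftrightarrow>
     (\<forall>v\<in>pverts G. h v \<in> pverts H) \<and> (\<forall>(v, w)\<in>parcs G. (h v, h w) \<in> parcs H)"

definition complete_graph :: "nat \<Rightarrow> nat pair_pre_digraph" where
  "complete_graph n =
     \<lparr>pverts = {1..n}, parcs = {(i, j). i \<in> {1..n} \<and> j \<in> {1..n} \<and> i \<noteq> j}\<rparr>"

text \<open>Only specified for graphs without loops; a graph with a loop admits no homomorphism to any
  complete graph.\<close>

definition chromatic_number :: "'a pair_pre_digraph \<Rightarrow> nat" where
  "chromatic_number G = (LEAST n. \<exists>h. graph_hom h G (complete_graph n))"

definition graph_prod ::
    "'a pair_pre_digraph \<Rightarrow> 'b pair_pre_digraph \<Rightarrow> ('a \<times> 'b) pair_pre_digraph" where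
  "graph_prod G H =
     \<lparr>pverts = pverts G \<times> pverts H,
      parcs = {((g, h), (g', h')). (g, g') \<in> parcs G \<and> (h, h') \<in> parcs H}\<rparr>"

definition graph_quotient ::
    "'a pair_pre_digraph \<Rightarrow> ('a \<times> 'a) set \<Rightarrow> 'a set pair_pre_digraph" where
  "graph_quotient G R =
     \<lparr>pverts = pverts G // R,
      parcs = {(A, B). A \<in> pverts G // R \<and> B \<in> pverts G // R \<and>
                       (\<exists>a\<in>A. \<exists>b\<in>B. (a, b) \<in> parcs G)}\<rparr>"

definition looped_path2 :: "nat pair_pre_digraph" where
  "looped_path2 =
     \<lparr>pverts = {0, 1, 2}, parcs = {(0, 0), (0, 1), (1, 0), (1, 2), (2, 1)}\<rparr>"

definition mycielskian :: "'a pair_pre_digraph \<Rightarrow> ('a \<times> nat) set pair_pre_digraph" where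
  "mycielskian G =
     (let P = graph_prod G looped_path2
      in graph_quotient P
           {(x, y). x \<in> pverts P \<and> y \<in> pverts P \<and> (x = y \<or> snd x = 2 \<and> snd y = 2)})"

text \<open>The graph written $H^G$. Set maps between the vertex sets are represented by the
  extensional functions of \<^const>\<open>PiE\<close>, so that each map is a single vertex. Note the order
  of the arguments: the base comes first.\<close>

definition exponential_graph ::
    "'b pair_pre_digraph \<Rightarrow> 'a pair_pre_digraph \<Rightarrow> ('a \<Rightarrow> 'b) pair_pre_digraph" where
  "exponential_graph H G =
     \<lparr>pverts = pverts G \<rightarrow>\<^sub>E pverts H,
      parcs = {(f, f'). f \<in> pverts G \<rightarrow>\<^sub>E pverts H \<and> f' \<in> pverts G \<rightarrow>\<^sub>E pverts H \<and>
                        (\<forall>(v, v')\<in>parcs G. (f v, f' v') \<in> parcs H)}\<rparr>"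

section \<open>The neighborhood complex as a space\<close>

text \<open>The empty set is a member whenever the graph has a vertex. Isolated vertices of the graph
  belong to no simplex.\<close>

definition neighborhood_simplices :: "'a pair_pre_digraph \<Rightarrow> 'a set set" where
  "neighborhood_simplices G =
     {A. A \<subseteq> pverts G \<and> (\<exists>x\<in>pverts G. \<forall>a\<in>A. (x, a) \<in> parcs G)}"

text \<open>Barycentric coordinates. The product topology is the right one only for finite complexes,
  and all complexes considered here are finite. Since the coordinates of a point sum to 1,
  the empty simplex contributes no point, so the realization of \<open>{{}}\<close> is the empty space.\<close>

definition geometric_realization :: "'a set set \<Rightarrow> ('a \<Rightarrow> real) topology" where
  "geometric_realization K =
     subtopology (powertop_real (\<Union>K))
       {t. (\<forall>v\<in>\<Union>K. 0 \<le> t v) \<and> (\<Sum>v\<in>\<Union>K. t v) = 1 \<and> {v \<in> \<Union>K. t v \<noteq> 0} \<in> K}"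

definition neighborhood_complex :: "'a pair_pre_digraph \<Rightarrow> ('a \<Rightarrow> real) topology" where
  "neighborhood_complex G = geometric_realization (neighborhood_simplices G)"

section \<open>Connectivity\<close>

text \<open>The sphere of dimension \<open>j \<ge> -1\<close>, where the sphere of dimension -1 is empty.\<close>

definition int_sphere :: "int \<Rightarrow> (nat \<Rightarrow> real) topology" where
  "int_sphere j = (if j < 0 then trivial_topology else nsphere (nat j))"

definition unit_ball :: "nat \<Rightarrow> (nat \<Rightarrow> real) topology" where
  "unit_ball d = subtopology (Euclidean_space d) {x. (\<Sum>i<d. x i ^ 2) \<le> 1}"

text \<open>The case \<open>j = -1\<close> says that the space is nonempty: a map from the empty sphere extends to
  the one-point ball of dimension 0. For nonempty spaces only \<open>0 \<le> j\<close> matters, and the empty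
  space is k-connected iff \<open>k \<le> -2\<close>.\<close>

definition k_connected :: "int \<Rightarrow> 'a topology \<Rightarrow> bool" where
  "k_connected k X \<longleftrightarrow>
     (\<forall>j. -1 \<le> j \<and> j \<le> k \<longrightarrow>
       (\<forall>f. continuous_map (int_sphere j) X f \<longrightarrow>
         (\<exists>g. continuous_map (unit_ball (nat (j + 1))) X g \<and>
              (\<forall>x\<in>topspace (int_sphere j). g x = f x))))"

text \<open>Unspecified if the space is k-connected for every k, as a contractible space is.\<close>

definition conn :: "'a topology \<Rightarrow> int" where
  "conn X = (GREATEST k. k_connected k X)"

end

theory Submission
  imports Defs "HOL-Homology.Homology"
begin

text \<open>Let \<open>H\<close> be the double Mycielskian of the complete graph on \<open>n\<close> vertices and let \<open>G\<close> be the
exponential graph whose vertices are the maps from \<open>H\<close> to the \<open>m\<close> colours. Whether a set of such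
maps has a common neighbor depends only on the sets of colours that the maps take at each vertex of
\<open>H\<close>: around every vertex of \<open>H\<close> some colour has to be missing. Replacing a convex combination of
maps by its marginal distributions, and distributions by their product, therefore identifies the
neighborhood complex up to homotopy with a space of multicolourings, in which every vertex of \<open>H\<close>
carries a point of the simplex on the colours (\<open>neighborhood_complex_exponential\<close>). The constant
multicolourings form a copy of the boundary of that simplex, which is a sphere of dimension
\<open>m - 2\<close>, so it remains to deform all multicolourings to constant ones.

The deformation uses the colours that occur at two different base vertices of the inner Mycielskian
(\<open>repeated\<close>). As \<open>m \<le> n\<close>, a pigeonhole argument shows that such a colour always exists, and a second
one that all these colours can be added to every vertex at once without violating the condition
(\<open>colour_retraction_repeated\<close>). Two multicolourings whose union is still admissible are joined by a
straight segment, so adding colours and then dropping others is a homotopy. On the outer Mycielskian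
two such steps suffice: one makes each of its two layers constant, the other merges the two constants
(\<open>retract_mycielskian\<close>, \<open>colouring_space_mycielskian\<close>).

For a single map a repeated colour is also what proves that \<open>m\<close> colours suffice for \<open>G\<close>: adjacent
maps have no repeated colour in common. The constant maps form a clique with \<open>m\<close> vertices, so the
chromatic number is \<open>m\<close>.

Finally the connectivity of a space that is homotopy equivalent to the sphere of dimension \<open>d\<close> is
\<open>d - 1\<close>. The identity of the sphere does not extend to the ball because spheres are not contractible.
A map from a sphere of smaller dimension extends to the ball because a Lipschitz approximation of a
Tietze extension misses a point near the origin, which is seen by counting grid points
(\<open>lipschitz_image_misses_point\<close>, \<open>nsphere_map_extends_to_ball\<close>).\<close>

section \<open>Mycielskians of graphs without isolated vertices\<close>

text \<open>The vertices of the Mycielskian are equivalence classes, hence sets of pairs. The classes of the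
pairs with second component 0 or 1 are singletons, the pairs with second component 2 form one class.\<close>

definition low :: "'a \<Rightarrow> ('a \<times> nat) set" where
  "low v = {(v, 0)}"

definition mid :: "'a \<Rightarrow> ('a \<times> nat) set" where
  "mid v = {(v, Suc 0)}"

definition apex :: "'a pair_pre_digraph \<Rightarrow> ('a \<times> nat) set" where
  "apex G = pverts G \<times> {2}"

lemma mycielskian_classes:
  fixes G :: "'a pair_pre_digraph"
  defines "P \<equiv> graph_prod G looped_path2"
  shows "pverts P // {(x, y). x \<in> pverts P \<and> y \<in> pverts P \<and> (x = y \<or> snd x = 2 \<and> snd y = 2)}
    = low ` pverts G \<union> mid ` pverts G \<union> (if pverts G = {} then {} else {apex G})"
proof -
  define R where "R = {(x, y). x \<in> pverts P \<and> y \<in> pverts P \<and> (x = y \<or> snd x = 2 \<and> snd y = 2)}"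
  have P: "pverts P = pverts G \<times> {0, 1, 2}"
    by (simp add: P_def graph_prod_def looped_path2_def)
  have *: "R `` {(v, k)} = (if k = 2 then pverts G \<times> {2} else {(v, k)})"
    if "v \<in> pverts G" "k \<in> {0,1,2}" for v k
    using that by (auto simp: P R_def)
  have "pverts P // R = (\<Union>x\<in>pverts G \<times> {0, 1, 2}. {R `` {x}})"
    by (simp only: quotient_def P)
  also have "\<dots> = (\<Union>v\<in>pverts G. \<Union>k\<in>{0,1,2}. {R `` {(v, k)}})"
    by blast
  also have "\<dots> = (\<Union>v\<in>pverts G. {low v, mid v, apex G})"
    by (rule SUP_cong) (simp_all add: * low_def mid_def apex_def insert_commute)
  finally show ?thesis unfolding R_def[symmetric] by auto
qed

lemma pverts_mycielskian:
  assumes "pverts G \<noteq> {}"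
  shows "pverts (mycielskian G) = low ` pverts G \<union> mid ` pverts G \<union> {apex G}"
  using assms mycielskian_classes[of G]
  by (simp add: mycielskian_def graph_quotient_def Let_def)

text \<open>The copy on level 1 of a vertex without neighbors would not be adjacent to the class of level 2, to
which the description below joins all of level 1. This is why isolated vertices are excluded
throughout.\<close>

lemma parcs_mycielskian:
  assumes ne: "pverts G \<noteq> {}" and sub: "parcs G \<subseteq> pverts G \<times> pverts G"
    and noniso: "\<And>v. v \<in> pverts G \<Longrightarrow> \<exists>w. (v, w) \<in> parcs G"
    and sym: "sym (parcs G)"
  shows "parcs (mycielskian G) =
    (\<Union>(v, w)\<in>parcs G. {(low v, low w), (low v, mid w), (mid v, low w)})
      \<union> (\<Union>v\<in>pverts G. {(mid v, apex G), (apex G, mid v)})" (is "_ = ?A")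
proof -
  let ?V = "low ` pverts G \<union> mid ` pverts G \<union> {apex G}"
  have "parcs (mycielskian G) = {(A, B). A \<in> ?V \<and> B \<in> ?V \<and>
      (\<exists>a\<in>A. \<exists>b\<in>B. (a, b) \<in> parcs (graph_prod G looped_path2))}"
    using ne mycielskian_classes[of G]
    by (simp add: mycielskian_def graph_quotient_def Let_def)
  also have "\<dots> = ?A"
  proof (intro subset_antisym subrelI)
    fix A B
    assume "(A, B) \<in> {(A, B). A \<in> ?V \<and> B \<in> ?V \<and>
      (\<exists>a\<in>A. \<exists>b\<in>B. (a, b) \<in> parcs (graph_prod G looped_path2))}"
    then obtain a i b j where AB: "A \<in> ?V" "B \<in> ?V" "(a, i) \<in> A" "(b, j) \<in> B"
      "((a, i), (b, j)) \<in> parcs (graph_prod G looped_path2)"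
      by fastforce
    then have ab: "(a, b) \<in> parcs G" and ij: "(i, j) \<in> {(0, 0), (0, 1), (1, 0), (1, 2), (2, 1)}"
      by (simp_all add: graph_prod_def looped_path2_def)
    have A: "A = (if i = 0 then low a else if i = 1 then mid a else apex G)" "a \<in> pverts G"
      using AB(1,3) by (auto simp: low_def mid_def apex_def)
    have B: "B = (if j = 0 then low b else if j = 1 then mid b else apex G)" "b \<in> pverts G"
      using AB(2,4) by (auto simp: low_def mid_def apex_def)
    show "(A, B) \<in> ?A"
      using ij ab A(2) B(2) unfolding A(1) B(1) by (elim insertE emptyE) auto
  next
    fix A B
    assume "(A, B) \<in> ?A"
    then show "(A, B) \<in> {(A, B). A \<in> ?V \<and> B \<in> ?V \<and>
      (\<exists>a\<in>A. \<exists>b\<in>B. (a, b) \<in> parcs (graph_prod G looped_path2))}"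
    proof (elim UnE UN_E)
      fix x
      assume "x \<in> parcs G" and *: "(A, B) \<in> (case x of (v, w) \<Rightarrow> {(low v, low w), (low v, mid w), (mid v, low w)})"
      then obtain v w where vw: "x = (v, w)" "(v, w) \<in> parcs G" "v \<in> pverts G" "w \<in> pverts G"
        using sub by (cases x) auto
      then show ?thesis
        using * vw(2-4) by (auto simp: vw(1) graph_prod_def looped_path2_def low_def mid_def apex_def)
    next
      fix v
      assume v: "v \<in> pverts G" and *: "(A, B) \<in> {(mid v, apex G), (apex G, mid v)}"
      obtain w where w: "(v, w) \<in> parcs G" "(w, v) \<in> parcs G" "w \<in> pverts G"
        using noniso[OF v] sym sub by (auto dest: symD)
      then have "((v, Suc 0), (w, 2)) \<in> parcs (graph_prod G looped_path2)"
        "((w, 2), (v, Suc 0)) \<in> parcs (graph_prod G looped_path2)"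
        by (simp_all add: graph_prod_def looped_path2_def)
      then show ?thesis
        using * v w(3) unfolding mid_def apex_def by blast
    qed
  qed
  finally show ?thesis .
qed

definition nonisolated_graph :: "'a pair_pre_digraph \<Rightarrow> bool" where
  "nonisolated_graph G \<longleftrightarrow> finite (pverts G) \<and> pverts G \<noteq> {} \<and> parcs G \<subseteq> pverts G \<times> pverts G \<and>
     sym (parcs G) \<and> (\<forall>v\<in>pverts G. \<exists>w. (v, w) \<in> parcs G)"

lemma nonisolated_complete_graph:
  assumes "2 \<le> n"
  shows "nonisolated_graph (complete_graph n)"
proof -
  have "\<exists>w. (v, w) \<in> parcs (complete_graph n)" if "v \<in> {1..n}" for v
    using that assms by (intro exI[of _ "if v = 1 then 2 else 1"]) (auto simp: complete_graph_def)
  then show ?thesis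
    using assms by (auto simp: nonisolated_graph_def complete_graph_def sym_def)
qed

lemma low_mid_apex_distinct [simp]:
  "low v \<noteq> mid w" "mid w \<noteq> low v" "low v \<noteq> apex G" "apex G \<noteq> low v"
  "mid v \<noteq> apex G" "apex G \<noteq> mid v"
  "low v = low w \<longleftrightarrow> v = w" "mid v = mid w \<longleftrightarrow> v = w"
proof -
  have "(u, 0) \<in> low u" "(u, 0) \<notin> apex G" "(u, 0) \<notin> mid u'" "(u, Suc 0) \<in> mid u" "(u, Suc 0) \<notin> apex G"
    for u u' :: 'a
    by (simp_all add: low_def mid_def apex_def)
  then show "low v \<noteq> mid w" "mid w \<noteq> low v" "low v \<noteq> apex G" "apex G \<noteq> low v"
    "mid v \<noteq> apex G" "apex G \<noteq> mid v"
    by metis+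
  show "low v = low w \<longleftrightarrow> v = w" "mid v = mid w \<longleftrightarrow> v = w"
    by (auto simp: low_def mid_def)
qed

text \<open>Neighborhoods are all that the admissibility condition below needs to know about the Mycielskian.\<close>

lemma
  assumes "nonisolated_graph G"
  shows low_adjacent: "(low v, x) \<in> parcs (mycielskian G) \<longleftrightarrow>
           (\<exists>w. (v, w) \<in> parcs G \<and> (x = low w \<or> x = mid w))"
    and mid_adjacent: "(mid v, x) \<in> parcs (mycielskian G) \<longleftrightarrow>
           (\<exists>w. (v, w) \<in> parcs G \<and> x = low w) \<or> v \<in> pverts G \<and> x = apex G"
    and apex_adjacent: "(apex G, x) \<in> parcs (mycielskian G) \<longleftrightarrow> (\<exists>v\<in>pverts G. x = mid v)"
    and vertices_mycielskian: "pverts (mycielskian G) = low ` pverts G \<union> mid ` pverts G \<union> {apex G}"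
proof -
  have V: "pverts G \<noteq> {}" and *: "parcs (mycielskian G) =
    (\<Union>(v, w)\<in>parcs G. {(low v, low w), (low v, mid w), (mid v, low w)})
      \<union> (\<Union>v\<in>pverts G. {(mid v, apex G), (apex G, mid v)})"
    using assms parcs_mycielskian[of G] by (simp_all add: nonisolated_graph_def)
  show "(low v, x) \<in> parcs (mycielskian G) \<longleftrightarrow> (\<exists>w. (v, w) \<in> parcs G \<and> (x = low w \<or> x = mid w))"
    unfolding * by auto
  show "(mid v, x) \<in> parcs (mycielskian G) \<longleftrightarrow>
           (\<exists>w. (v, w) \<in> parcs G \<and> x = low w) \<or> v \<in> pverts G \<and> x = apex G"
    unfolding * by auto
  show "(apex G, x) \<in> parcs (mycielskian G) \<longleftrightarrow> (\<exists>v\<in>pverts G. x = mid v)"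
    unfolding * by auto
  show "pverts (mycielskian G) = low ` pverts G \<union> mid ` pverts G \<union> {apex G}"
    using V by (rule pverts_mycielskian)
qed

lemma nonisolated_mycielskian:
  assumes G: "nonisolated_graph G"
  shows "nonisolated_graph (mycielskian G)"
proof -
  have fin: "finite (pverts G)" and sub: "parcs G \<subseteq> pverts G \<times> pverts G" and ne: "pverts G \<noteq> {}"
    and sym: "\<And>v w. (v, w) \<in> parcs G \<Longrightarrow> (w, v) \<in> parcs G"
    and noniso: "\<And>v. v \<in> pverts G \<Longrightarrow> \<exists>w. (v, w) \<in> parcs G"
    using G by (auto simp: nonisolated_graph_def dest: symD)
  have parcs: "parcs (mycielskian G) =
    (\<Union>(v, w)\<in>parcs G. {(low v, low w), (low v, mid w), (mid v, low w)})
      \<union> (\<Union>v\<in>pverts G. {(mid v, apex G), (apex G, mid v)})"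
    using G parcs_mycielskian[of G] by (simp add: nonisolated_graph_def)
  show ?thesis
    unfolding nonisolated_graph_def
  proof (intro conjI)
    show "finite (pverts (mycielskian G))" "pverts (mycielskian G) \<noteq> {}"
      using fin by (simp_all add: vertices_mycielskian[OF G])
    show "parcs (mycielskian G) \<subseteq> pverts (mycielskian G) \<times> pverts (mycielskian G)"
      unfolding parcs vertices_mycielskian[OF G] using sub by blast
    show "sym (parcs (mycielskian G))"
      unfolding parcs using sym by (intro symI) blast
    show "\<forall>v\<in>pverts (mycielskian G). \<exists>w. (v, w) \<in> parcs (mycielskian G)"
      unfolding vertices_mycielskian[OF G] using noniso ne
      by (blast intro: low_adjacent[OF G, THEN iffD2] mid_adjacent[OF G, THEN iffD2]
          apex_adjacent[OF G, THEN iffD2])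
  qed
qed

lemma pverts_complete_graph: "pverts (complete_graph n) = {1..n}"
  by (simp add: complete_graph_def)

lemma parcs_complete_graph:
  "(i, j) \<in> parcs (complete_graph n) \<longleftrightarrow> i \<in> {1..n} \<and> j \<in> {1..n} \<and> i \<noteq> j"
  by (simp add: complete_graph_def)

section \<open>Multicolourings and the colours that can be added to them\<close>

text \<open>A multicolouring assigns a nonempty set of colours to each vertex. It is admissible if the box of all
maps that choose one of the colours at each vertex has a common neighbor in the exponential graph:
a common neighbor picks at \<open>w\<close> one of the colours \<open>b\<close> missing around \<open>w\<close>.\<close>

definition admissible :: "'a pair_pre_digraph \<Rightarrow> nat \<Rightarrow> ('a \<Rightarrow> nat set) \<Rightarrow> bool" where
  "admissible H m \<phi> \<longleftrightarrow> (\<forall>v\<in>pverts H. \<phi> v \<noteq> {} \<and> \<phi> v \<subseteq> {1..m}) \<and>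
     (\<forall>w\<in>pverts H. \<exists>b\<in>{1..m}. \<forall>v. (w, v) \<in> parcs H \<longrightarrow> b \<notin> \<phi> v)"

text \<open>The combinatorial core of a deformation of all multicolourings of \<open>H\<close> to constant ones. The passage
from \<open>\<phi>\<close> to the constant \<open>R \<phi>\<close> goes through their union, which has to be admissible. Monotonicity
is what makes the property survive the Mycielskian: there \<open>R\<close> is applied to parts of a
multicolouring, and the result has to be compared with \<open>R\<close> of a union.\<close>

definition colour_retraction ::
    "'a pair_pre_digraph \<Rightarrow> nat \<Rightarrow> (('a \<Rightarrow> nat set) \<Rightarrow> nat set) \<Rightarrow> bool" where
  "colour_retraction H m R \<longleftrightarrow>
     (\<forall>\<phi>. admissible H m \<phi> \<longrightarrow>
        R \<phi> \<noteq> {} \<and> R \<phi> \<subseteq> (\<Union>v\<in>pverts H. \<phi> v) \<and> admissible H m (\<lambda>v. \<phi> v \<union> R \<phi>)) \<and>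
     (\<forall>\<phi> \<psi>. (\<forall>v\<in>pverts H. \<phi> v \<subseteq> \<psi> v) \<longrightarrow> R \<phi> \<subseteq> R \<psi>) \<and> (\<forall>A. R (\<lambda>_. A) = A)"

lemma admissible_mycielskian:
  assumes G: "nonisolated_graph G"
  shows "admissible (mycielskian G) m \<phi> \<longleftrightarrow>
     (\<forall>v\<in>pverts G. \<phi> (low v) \<noteq> {} \<and> \<phi> (low v) \<subseteq> {1..m} \<and> \<phi> (mid v) \<noteq> {} \<and> \<phi> (mid v) \<subseteq> {1..m}) \<and>
     \<phi> (apex G) \<noteq> {} \<and> \<phi> (apex G) \<subseteq> {1..m} \<and>
     (\<forall>w\<in>pverts G. \<exists>b\<in>{1..m}. \<forall>v. (w, v) \<in> parcs G \<longrightarrow> b \<notin> \<phi> (low v) \<and> b \<notin> \<phi> (mid v)) \<and>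
     (\<forall>w\<in>pverts G. \<exists>b\<in>{1..m}. b \<notin> \<phi> (apex G) \<and> (\<forall>v. (w, v) \<in> parcs G \<longrightarrow> b \<notin> \<phi> (low v))) \<and>
     (\<exists>b\<in>{1..m}. \<forall>v\<in>pverts G. b \<notin> \<phi> (mid v))"
proof -
  have 1: "(\<forall>x. (low w, x) \<in> parcs (mycielskian G) \<longrightarrow> b \<notin> \<phi> x) \<longleftrightarrow>
      (\<forall>v. (w, v) \<in> parcs G \<longrightarrow> b \<notin> \<phi> (low v) \<and> b \<notin> \<phi> (mid v))" for w b
    unfolding low_adjacent[OF G] by blast
  have 2: "(\<forall>x. (mid w, x) \<in> parcs (mycielskian G) \<longrightarrow> b \<notin> \<phi> x) \<longleftrightarrow>
      b \<notin> \<phi> (apex G) \<and> (\<forall>v. (w, v) \<in> parcs G \<longrightarrow> b \<notin> \<phi> (low v))" if "w \<in> pverts G" for w b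
    unfolding mid_adjacent[OF G] using that by blast
  have 3: "(\<forall>x. (apex G, x) \<in> parcs (mycielskian G) \<longrightarrow> b \<notin> \<phi> x) \<longleftrightarrow>
      (\<forall>v\<in>pverts G. b \<notin> \<phi> (mid v))" for b
    unfolding apex_adjacent[OF G] by blast
  have 2: "(\<forall>w\<in>pverts G. \<exists>b\<in>{1..m}. \<forall>x. (mid w, x) \<in> parcs (mycielskian G) \<longrightarrow> b \<notin> \<phi> x) \<longleftrightarrow>
      (\<forall>w\<in>pverts G. \<exists>b\<in>{1..m}. b \<notin> \<phi> (apex G) \<and> (\<forall>v. (w, v) \<in> parcs G \<longrightarrow> b \<notin> \<phi> (low v)))"
    by (intro ball_cong bex_cong refl 2)
  show ?thesis
    unfolding admissible_def vertices_mycielskian[OF G] ball_Un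
    by (simp add: 1 2[simplified] 3 ball_conj_distrib conj_ac)
qed

text \<open>The two layers \<open>\<phi>\<^sub>0\<close> and \<open>\<phi>\<^sub>1\<close> of a multicolouring of the Mycielskian satisfy: \<open>\<phi>\<^sub>0 \<union> \<phi>\<^sub>1\<close> is admissible
(look around the vertices of level 0), and so is the union of \<open>\<phi>\<^sub>0\<close> with the colours at the apex (look
around level 1). By monotonicity \<open>R (\<phi>\<^sub>0 \<union> \<phi>\<^sub>1)\<close> contains both \<open>A\<close> and \<open>B\<close>, so these can be added on
levels 0 and 1 together. Around the apex only level 1 counts, and there \<open>B\<close> adds nothing new since
its colours already occur on that level. This gives the third claim. Once the layers are the constants
\<open>A\<close> and \<open>B\<close>, a colour outside both is missing everywhere, which gives the fourth.\<close>

lemma retract_mycielskian: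
  assumes G: "nonisolated_graph G" and R: "colour_retraction G m R"
    and \<phi>: "admissible (mycielskian G) m \<phi>"
  defines "A \<equiv> R (\<lambda>v. \<phi> (low v))" and "B \<equiv> R (\<lambda>v. \<phi> (mid v))"
  shows "admissible G m (\<lambda>v. \<phi> (low v))" "admissible G m (\<lambda>v. \<phi> (mid v))"
    and "admissible (mycielskian G) m (\<lambda>x. \<phi> x \<union> (if x \<in> mid ` pverts G then B else A))"
    and "admissible (mycielskian G) m (\<lambda>x. A \<union> (if x \<in> mid ` pverts G then B else {}))"
proof -
  have mono: "R \<phi> \<subseteq> R \<psi>" if "\<And>v. v \<in> pverts G \<Longrightarrow> \<phi> v \<subseteq> \<psi> v" for \<phi> \<psi>
    using R that unfolding colour_retraction_def by simp
  have ne: "R \<psi> \<noteq> {}" and sub: "R \<psi> \<subseteq> (\<Union>v\<in>pverts G. \<psi> v)"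
    and un: "admissible G m (\<lambda>v. \<psi> v \<union> R \<psi>)" if "admissible G m \<psi>" for \<psi>
    using R that unfolding colour_retraction_def by blast+
  have nbr: "\<exists>v. (w, v) \<in> parcs G \<and> v \<in> pverts G" if "w \<in> pverts G" for w
    using G that unfolding nonisolated_graph_def by blast
  note \<phi>' = \<phi>[unfolded admissible_mycielskian[OF G]]
  show adm0: "admissible G m (\<lambda>v. \<phi> (low v))" and adm1: "admissible G m (\<lambda>v. \<phi> (mid v))"
    using \<phi>' unfolding admissible_def by blast+
  have adm01: "admissible G m (\<lambda>v. \<phi> (low v) \<union> \<phi> (mid v))"
    and adm0a: "admissible G m (\<lambda>v. \<phi> (low v) \<union> \<phi> (apex G))"
    using \<phi>' unfolding admissible_def by blast+
  have low_sub: "\<phi> (low v) \<noteq> {}" "\<phi> (low v) \<subseteq> {1..m}" "\<phi> (mid v) \<noteq> {}" "\<phi> (mid v) \<subseteq> {1..m}"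
    if "v \<in> pverts G" for v
    using \<phi>'[THEN conjunct1] that by simp_all
  have apex_sub: "\<phi> (apex G) \<noteq> {}" "\<phi> (apex G) \<subseteq> {1..m}"
    using \<phi>' by simp_all
  have A: "A \<noteq> {}" "A \<subseteq> {1..m}"
    using ne[OF adm0] order.trans[OF sub[OF adm0] UN_least[OF low_sub(2)]] by (simp_all add: A_def)
  have B: "B \<noteq> {}" "B \<subseteq> {1..m}" "B \<subseteq> (\<Union>v\<in>pverts G. \<phi> (mid v))"
    using ne[OF adm1] sub[OF adm1] order.trans[OF sub[OF adm1] UN_least[OF low_sub(4)]]
    by (simp_all add: B_def)
  have A01: "A \<subseteq> R (\<lambda>v. \<phi> (low v) \<union> \<phi> (mid v))" and B01: "B \<subseteq> R (\<lambda>v. \<phi> (low v) \<union> \<phi> (mid v))"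
    and Aa: "A \<subseteq> R (\<lambda>v. \<phi> (low v) \<union> \<phi> (apex G))"
    unfolding A_def B_def by (rule mono; simp)+
  have l: "\<exists>b\<in>{1..m}. \<forall>v. (w, v) \<in> parcs G \<longrightarrow> b \<notin> \<phi> (low v) \<union> A \<union> B \<and> b \<notin> \<phi> (mid v) \<union> A \<union> B"
    if "w \<in> pverts G" for w
    using un[OF adm01, unfolded admissible_def, THEN conjunct2, rule_format, OF that] A01 B01
    by blast
  have a: "\<exists>b\<in>{1..m}. \<forall>v. (w, v) \<in> parcs G \<longrightarrow> b \<notin> \<phi> (low v) \<union> A \<union> \<phi> (apex G)"
    if "w \<in> pverts G" for w
    using un[OF adm0a, unfolded admissible_def, THEN conjunct2, rule_format, OF that] Aa
    by blast
  obtain b where b: "b \<in> {1..m}" "\<forall>v\<in>pverts G. b \<notin> \<phi> (mid v)"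
    using \<phi>' by blast
  have l': "\<exists>b\<in>{1..m}. b \<notin> A \<union> B"
  proof -
    obtain w where w: "w \<in> pverts G"
      using G by (auto simp: nonisolated_graph_def)
    then show ?thesis
      using l[OF w] nbr[OF w] by blast
  qed
  have a': "\<forall>w\<in>pverts G. \<exists>b\<in>{1..m}. b \<notin> \<phi> (apex G) \<union> A \<and> (\<forall>v. (w, v) \<in> parcs G \<longrightarrow> b \<notin> \<phi> (low v) \<union> A)"
  proof
    fix w assume w: "w \<in> pverts G"
    obtain v where v: "(w, v) \<in> parcs G"
      using nbr[OF w] by blast
    obtain b where b: "b \<in> {1..m}" "\<And>v. (w, v) \<in> parcs G \<Longrightarrow> b \<notin> \<phi> (low v) \<union> A \<union> \<phi> (apex G)"
      using a[OF w] by blast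
    show "\<exists>b\<in>{1..m}. b \<notin> \<phi> (apex G) \<union> A \<and> (\<forall>v. (w, v) \<in> parcs G \<longrightarrow> b \<notin> \<phi> (low v) \<union> A)"
      using b(2) b(2)[OF v] by (intro bexI[OF _ b(1)]) simp
  qed
  have low_eq: "(if low v \<in> mid ` pverts G then B else C) = C"
    and apex_eq: "(if apex G \<in> mid ` pverts G then B else C) = C" for v C
    by auto
  have mid_eq: "(if mid v \<in> mid ` pverts G then B else C) = B" if "v \<in> pverts G" for v C
    using that by auto
  have inG: "v \<in> pverts G" if "(w, v) \<in> parcs G" for v w
    using that G unfolding nonisolated_graph_def by blast
  show "admissible (mycielskian G) m (\<lambda>x. \<phi> x \<union> (if x \<in> mid ` pverts G then B else A))"
    unfolding admissible_mycielskian[OF G] low_eq apex_eq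
  proof (intro conjI ballI)
    fix v assume v: "v \<in> pverts G"
    show "\<phi> (low v) \<union> A \<noteq> {}" "\<phi> (low v) \<union> A \<subseteq> {1..m}"
      "\<phi> (mid v) \<union> (if mid v \<in> mid ` pverts G then B else A) \<noteq> {}"
      "\<phi> (mid v) \<union> (if mid v \<in> mid ` pverts G then B else A) \<subseteq> {1..m}"
      unfolding mid_eq[OF v] using low_sub[OF v] A B by auto
    show "\<exists>b\<in>{1..m}. \<forall>v'. (v, v') \<in> parcs G \<longrightarrow>
        b \<notin> \<phi> (low v') \<union> A \<and> b \<notin> \<phi> (mid v') \<union> (if mid v' \<in> mid ` pverts G then B else A)"
    proof -
      obtain b where b: "b \<in> {1..m}"
        "\<And>v'. (v, v') \<in> parcs G \<Longrightarrow> b \<notin> \<phi> (low v') \<union> A \<union> B \<and> b \<notin> \<phi> (mid v') \<union> A \<union> B"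
        using l[OF v] by blast
      show ?thesis
        by (rule bexI[OF _ b(1)]) (use b(2) mid_eq[OF inG] in simp)
    qed
    show "\<exists>b\<in>{1..m}. b \<notin> \<phi> (apex G) \<union> A \<and> (\<forall>v'. (v, v') \<in> parcs G \<longrightarrow> b \<notin> \<phi> (low v') \<union> A)"
      using a'[rule_format, OF v] .
  next
    show "\<phi> (apex G) \<union> A \<noteq> {}" "\<phi> (apex G) \<union> A \<subseteq> {1..m}"
      using apex_sub A by auto
    show "\<exists>b\<in>{1..m}. \<forall>v\<in>pverts G. b \<notin> \<phi> (mid v) \<union> (if mid v \<in> mid ` pverts G then B else A)"
      using b B(3) mid_eq by (intro bexI[of _ b]) auto
  qed
  show "admissible (mycielskian G) m (\<lambda>x. A \<union> (if x \<in> mid ` pverts G then B else {}))"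
    unfolding admissible_mycielskian[OF G] low_eq apex_eq
  proof (intro conjI ballI)
    fix v assume v: "v \<in> pverts G"
    show "A \<union> {} \<noteq> {}" "A \<union> {} \<subseteq> {1..m}"
      "A \<union> (if mid v \<in> mid ` pverts G then B else {}) \<noteq> {}"
      "A \<union> (if mid v \<in> mid ` pverts G then B else {}) \<subseteq> {1..m}"
      unfolding mid_eq[OF v] using A B by auto
    show "\<exists>b\<in>{1..m}. \<forall>v'. (v, v') \<in> parcs G \<longrightarrow>
        b \<notin> A \<union> {} \<and> b \<notin> A \<union> (if mid v' \<in> mid ` pverts G then B else {})"
      using l' by auto
    show "\<exists>b\<in>{1..m}. b \<notin> A \<union> {} \<and> (\<forall>v'. (v, v') \<in> parcs G \<longrightarrow> b \<notin> A \<union> {})"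
      using l' by auto
  next
    show "A \<union> {} \<noteq> {}" "A \<union> {} \<subseteq> {1..m}"
      using A by auto
    show "\<exists>b\<in>{1..m}. \<forall>v\<in>pverts G. b \<notin> A \<union> (if mid v \<in> mid ` pverts G then B else {})"
      using l' by auto
  qed
qed

text \<open>Around each vertex of the levels 0 and 1 of the Mycielskian of a complete graph all base vertices but
one are visible, so a colour occurring at two base vertices is visible from everywhere except
the apex.\<close>

definition repeated :: "nat \<Rightarrow> ((nat \<times> nat) set \<Rightarrow> nat set) \<Rightarrow> nat set" where
  "repeated n \<phi> = {c. \<exists>i\<in>{1..n}. \<exists>j\<in>{1..n}. i \<noteq> j \<and> c \<in> \<phi> (low i) \<and> c \<in> \<phi> (low j)}"

text \<open>Let \<open>a i\<close> be a colour missing around the base vertex \<open>i\<close>. If no colour were repeated, then \<open>n\<close>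
disjoint nonempty sets of colours would force \<open>m = n\<close> and a bijection \<open>f\<close> with \<open>f i \<in> \<phi> (low i)\<close>;
then \<open>a i = f i\<close>, so \<open>f i\<close> is the only colour left for \<open>mid i\<close>, and the vertices of level 1 use all
colours, leaving none for the apex.

Repeated colours are visible from levels 0 and 1 anyway, so adding them everywhere can only fail at
the apex. If it did, every colour would be repeated or occur on level 1. As \<open>a i\<close> is not repeated and
does not occur at \<open>mid j\<close> for \<open>j \<noteq> i\<close>, it occurs at \<open>mid i\<close> and nowhere else on that level. Hence \<open>a\<close>
is injective and avoids a repeated colour, which is impossible for \<open>m \<le> n\<close>.\<close>

lemma colour_retraction_repeated:
  assumes n: "2 \<le> n" and mn: "m \<le> n"
  shows "colour_retraction (mycielskian (complete_graph n)) m (repeated n)"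
proof -
  let ?K = "complete_graph n"
  note K = nonisolated_complete_graph[OF n]
  have V: "pverts ?K = {1..n}" and adj: "\<And>i j. (i, j) \<in> parcs ?K \<longleftrightarrow> i \<in> {1..n} \<and> j \<in> {1..n} \<and> i \<noteq> j"
    by (simp_all add: complete_graph_def)
  have main: "repeated n \<phi> \<noteq> {} \<and> admissible (mycielskian ?K) m (\<lambda>v. \<phi> v \<union> repeated n \<phi>)"
    if \<phi>: "admissible (mycielskian ?K) m \<phi>" for \<phi>
  proof
    let ?R = "repeated n \<phi>"
    note \<phi>' = \<phi>[unfolded admissible_mycielskian[OF K], unfolded V adj]
    have low: "\<phi> (low i) \<noteq> {}" "\<phi> (low i) \<subseteq> {1..m}" and mid: "\<phi> (mid i) \<noteq> {}" "\<phi> (mid i) \<subseteq> {1..m}"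
      if "i \<in> {1..n}" for i
      using \<phi>'[THEN conjunct1, rule_format, OF that] by simp_all
    have apex: "\<phi> (apex ?K) \<noteq> {}" "\<phi> (apex ?K) \<subseteq> {1..m}"
      using \<phi>'[THEN conjunct2] by (rule conjunct1, rule conjunct1[OF conjunct2])
    have spare_low: "\<exists>b\<in>{1..m}. \<forall>j. i \<in> {1..n} \<and> j \<in> {1..n} \<and> i \<noteq> j \<longrightarrow> b \<notin> \<phi> (low j) \<and> b \<notin> \<phi> (mid j)"
      if "i \<in> {1..n}" for i
      using \<phi>'[THEN conjunct2, THEN conjunct2, THEN conjunct2, THEN conjunct1] that by (rule bspec)
    have spare_mid: "\<exists>b\<in>{1..m}. b \<notin> \<phi> (apex ?K) \<and> (\<forall>j. i \<in> {1..n} \<and> j \<in> {1..n} \<and> i \<noteq> j \<longrightarrow> b \<notin> \<phi> (low j))"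
      if "i \<in> {1..n}" for i
      using \<phi>'[THEN conjunct2, THEN conjunct2, THEN conjunct2, THEN conjunct2, THEN conjunct1] that
      by (rule bspec)
    have spare_apex: "\<exists>b\<in>{1..m}. \<forall>j\<in>{1..n}. b \<notin> \<phi> (mid j)"
      using \<phi>'[THEN conjunct2, THEN conjunct2, THEN conjunct2, THEN conjunct2, THEN conjunct2] .
    have "\<forall>i\<in>{1..n}. \<exists>b. b\<in>{1..m} \<and> (\<forall>j\<in>{1..n}. i \<noteq> j \<longrightarrow> b \<notin> \<phi> (low j) \<and> b \<notin> \<phi> (mid j))"
    proof
      fix i assume i: "i \<in> {1..n}"
      then obtain b where "b \<in> {1..m}"
        "\<forall>j. i \<in> {1..n} \<and> j \<in> {1..n} \<and> i \<noteq> j \<longrightarrow> b \<notin> \<phi> (low j) \<and> b \<notin> \<phi> (mid j)"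
        using spare_low[OF i] by blast
      then show "\<exists>b. b\<in>{1..m} \<and> (\<forall>j\<in>{1..n}. i \<noteq> j \<longrightarrow> b \<notin> \<phi> (low j) \<and> b \<notin> \<phi> (mid j))"
        using i by (intro exI[of _ b]) simp
    qed
    then obtain a where a: "\<And>i. i \<in> {1..n} \<Longrightarrow> a i \<in> {1..m}"
      "\<And>i j. i \<in> {1..n} \<Longrightarrow> j \<in> {1..n} \<Longrightarrow> i \<noteq> j \<Longrightarrow> a i \<notin> \<phi> (low j) \<and> a i \<notin> \<phi> (mid j)"
      unfolding bchoice_iff by blast
    obtain b where b: "b \<in> {1..m}" "\<And>j. j \<in> {1..n} \<Longrightarrow> b \<notin> \<phi> (mid j)"
      using spare_apex by blast
    show ne: "?R \<noteq> {}"
    proof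
      assume R: "?R = {}"
      have "\<forall>i\<in>{1..n}. \<exists>c. c \<in> \<phi> (low i)"
        using low(1) by blast
      then obtain f where f: "\<And>i. i \<in> {1..n} \<Longrightarrow> f i \<in> \<phi> (low i)"
        unfolding bchoice_iff by blast
      have "inj_on f {1..n}"
      proof (rule inj_onI, rule ccontr)
        fix i j assume ij: "i \<in> {1..n}" "j \<in> {1..n}" "f i = f j" "i \<noteq> j"
        then have "f i \<in> ?R"
          using f[of i] f[of j] unfolding repeated_def by (intro CollectI bexI[of _ i] bexI[of _ j]) simp_all
        with R show False by simp
      qed
      moreover have "f ` {1..n} \<subseteq> {1..m}"
        using f low(2) by blast
      ultimately have onto: "f ` {1..n} = {1..m}"
        using mn by (intro card_seteq) (simp_all add: card_image)
      have a_f: "a i = f i" if i: "i \<in> {1..n}" for i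
      proof -
        obtain k where "k \<in> {1..n}" "a i = f k"
          using onto a(1)[OF i] by blast
        then show ?thesis
          using a(2)[OF i, of k] f[of k] by (cases "i = k") auto
      qed
      then have other: "f i \<notin> \<phi> (mid j)" if "i \<in> {1..n}" "j \<in> {1..n}" "i \<noteq> j" for i j
        using a(2)[OF that] a_f[OF that(1)] by simp
      have own: "f j \<in> \<phi> (mid j)" if j: "j \<in> {1..n}" for j
      proof -
        obtain c where "c \<in> \<phi> (mid j)" "c \<in> {1..m}"
          using mid[OF j] by blast
        moreover obtain i where "i \<in> {1..n}" "c = f i"
          using onto \<open>c \<in> {1..m}\<close> by blast
        ultimately show ?thesis
          using other[OF _ j, of i] by blast
      qed
      obtain j where "j \<in> {1..n}" "b = f j"
        using b(1) onto by blast
      then show False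
        using b(2) own by blast
    qed
    have Rsub: "?R \<subseteq> {1..m}"
      using low(2) unfolding repeated_def by blast
    have spread: "\<exists>j\<in>{1..n}. i \<noteq> j \<and> c \<in> \<phi> (low j)" if "c \<in> ?R" for i c
    proof -
      obtain p q where "p \<in> {1..n}" "q \<in> {1..n}" "p \<noteq> q" "c \<in> \<phi> (low p)" "c \<in> \<phi> (low q)"
        using \<open>c \<in> ?R\<close> unfolding repeated_def by blast
      then show ?thesis
        by (intro bexI[of _ "if i = p then q else p"]) auto
    qed
    have aR: "a i \<notin> ?R" if "i \<in> {1..n}" for i
      using spread[of "a i" i] a(2)[OF that] by blast
    have top: "\<exists>b\<in>{1..m}. \<forall>j\<in>{1..n}. b \<notin> \<phi> (mid j) \<union> ?R"
    proof (rule ccontr)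
      assume contra: "\<not> ?thesis"
      have "a i \<in> \<phi> (mid i)" if i: "i \<in> {1..n}" for i
      proof -
        obtain j where j: "j \<in> {1..n}" "a i \<in> \<phi> (mid j)"
          using contra a(1)[OF i] aR[OF i] by blast
        then show ?thesis
          using a(2)[OF i j(1)] by (cases "i = j") auto
      qed
      then have "inj_on a {1..n}"
        using a(2) by (intro inj_onI) metis
      then have "n \<le> card ({1..m} - ?R)"
        using aR a(1) by (intro order.trans[OF _ card_mono[of "{1..m} - ?R" "a ` {1..n}"]])
          (simp_all add: card_image image_subset_iff)
      also have "\<dots> < m"
      proof -
        have "{1..m} - ?R \<subset> {1..m}"
          using ne Rsub by blast
        then show ?thesis
          using psubset_card_mono[of "{1..m}"] by simp
      qed
      finally show False using mn by simp
    qed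
    have midR: "\<exists>b\<in>{1..m}. b \<notin> \<phi> (apex ?K) \<union> ?R \<and> (\<forall>j. i \<in> {1..n} \<and> j \<in> {1..n} \<and> i \<noteq> j \<longrightarrow> b \<notin> \<phi> (low j) \<union> ?R)"
      if i: "i \<in> {1..n}" for i
    proof -
      obtain b where "b \<in> {1..m}" "b \<notin> \<phi> (apex ?K)" "\<forall>j. i \<in> {1..n} \<and> j \<in> {1..n} \<and> i \<noteq> j \<longrightarrow> b \<notin> \<phi> (low j)"
        using spare_mid[OF i] by blast
      moreover from this have "b \<notin> ?R"
        using spread[of b i] i by blast
      ultimately show ?thesis
        by (intro bexI[of _ b]) simp_all
    qed
    show "admissible (mycielskian ?K) m (\<lambda>v. \<phi> v \<union> ?R)"
      unfolding admissible_mycielskian[OF K] V adj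
    proof (intro conjI ballI)
      fix i assume i: "i \<in> {1..n}"
      show "\<phi> (low i) \<union> ?R \<noteq> {}" "\<phi> (low i) \<union> ?R \<subseteq> {1..m}"
        "\<phi> (mid i) \<union> ?R \<noteq> {}" "\<phi> (mid i) \<union> ?R \<subseteq> {1..m}"
        using low[OF i] mid[OF i] Rsub by simp_all
      show "\<exists>b\<in>{1..m}. \<forall>j. i \<in> {1..n} \<and> j \<in> {1..n} \<and> i \<noteq> j \<longrightarrow> b \<notin> \<phi> (low j) \<union> ?R \<and> b \<notin> \<phi> (mid j) \<union> ?R"
        using a aR i by (intro bexI[of _ "a i"]) simp_all
      show "\<exists>b\<in>{1..m}. b \<notin> \<phi> (apex ?K) \<union> ?R \<and> (\<forall>j. i \<in> {1..n} \<and> j \<in> {1..n} \<and> i \<noteq> j \<longrightarrow> b \<notin> \<phi> (low j) \<union> ?R)"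
        using midR[OF i] .
    next
      show "\<phi> (apex ?K) \<union> ?R \<noteq> {}" "\<phi> (apex ?K) \<union> ?R \<subseteq> {1..m}"
        using apex Rsub by simp_all
    qed (rule top)
  qed
  have sub: "repeated n \<phi> \<subseteq> (\<Union>v\<in>pverts (mycielskian ?K). \<phi> v)" for \<phi>
    unfolding vertices_mycielskian[OF K] V repeated_def by blast
  have mono: "repeated n \<phi> \<subseteq> repeated n \<psi>"
    if "\<forall>v\<in>pverts (mycielskian ?K). \<phi> v \<subseteq> \<psi> v" for \<phi> \<psi>
    using that unfolding vertices_mycielskian[OF K] V repeated_def by blast
  have const: "repeated n (\<lambda>_. A) = A" for A
  proof -
    have "1 \<in> {1..n}" "2 \<in> {1..n}" "(1::nat) \<noteq> 2"
      using n by auto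
    then show ?thesis
      unfolding repeated_def by blast
  qed
  show ?thesis
    unfolding colour_retraction_def
    by (intro conjI allI impI main[THEN conjunct1] main[THEN conjunct2] sub mono const)
qed

section \<open>Straight-line homotopies in spaces of multicolourings\<close>

text \<open>Every deformation of multicolourings and of distributions on maps is of this form.\<close>

lemma homotopic_linear:
  fixes S :: "('i \<Rightarrow> real) set"
  assumes p: "continuous_map Y (subtopology (powertop_real I) S) p"
    and q: "continuous_map Y (subtopology (powertop_real I) S) q"
    and seg: "\<And>y s. \<lbrakk>y \<in> topspace Y; 0 \<le> s; s \<le> 1\<rbrakk>
        \<Longrightarrow> (\<lambda>i\<in>I. (1 - s) * p y i + s * q y i) \<in> S"
  shows "homotopic_with (\<lambda>_. True) Y (subtopology (powertop_real I) S) p q"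
proof -
  let ?T = "top_of_set {0..1::real}"
  let ?h = "\<lambda>z. \<lambda>i\<in>I. (1 - fst z) * p (snd z) i + fst z * q (snd z) i"
  have pI: "p y \<in> extensional I" and qI: "q y \<in> extensional I" if "y \<in> topspace Y" for y
    using continuous_map_image_subset_topspace[OF p] continuous_map_image_subset_topspace[OF q] that
    by (auto simp: PiE_def image_subset_iff Pi_iff)
  have fst: "continuous_map (prod_topology ?T Y) euclideanreal fst"
    using continuous_map_fst[of ?T Y] by (rule continuous_map_into_fulltopology)
  have coord: "continuous_map (prod_topology ?T Y) euclideanreal (\<lambda>z. r (snd z) i)"
    if r: "continuous_map Y (subtopology (powertop_real I) S) r" and "i \<in> I" for r i
  proof -
    have "continuous_map Y euclideanreal (\<lambda>y. r y i)"
      using r \<open>i \<in> I\<close> by (simp add: continuous_map_in_subtopology continuous_map_componentwise)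
    then show ?thesis
      using continuous_map_compose[OF continuous_map_snd[of ?T Y]] by (fastforce simp: o_def)
  qed
  have "continuous_map (prod_topology ?T Y) (subtopology (powertop_real I) S) ?h"
    unfolding continuous_map_in_subtopology continuous_map_componentwise
  proof (intro conjI ballI)
    fix i assume i: "i \<in> I"
    have "continuous_map (prod_topology ?T Y) euclideanreal
        (\<lambda>z. (1 - fst z) * p (snd z) i + fst z * q (snd z) i)"
      by (intro continuous_intros fst coord[OF p i] coord[OF q i]) auto
    then show "continuous_map (prod_topology ?T Y) euclideanreal (\<lambda>z. ?h z i)"
      using i by simp
  qed (use seg in \<open>auto simp: image_subset_iff\<close>)
  then show ?thesis
    using pI qI
    by (subst homotopic_with)
      (auto intro!: exI[of _ ?h] extensionalityI[where A = I])
qed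

text \<open>A point of the space of multicolourings is stored as one function on pairs of a vertex and a colour,
so that the space is a subspace of a single product of real lines.\<close>

definition support :: "nat \<Rightarrow> ('a \<times> nat \<Rightarrow> real) \<Rightarrow> 'a \<Rightarrow> nat set" where
  "support m x v = {c \<in> {1..m}. x (v, c) \<noteq> 0}"

definition colouring_points :: "'a pair_pre_digraph \<Rightarrow> nat \<Rightarrow> ('a \<times> nat \<Rightarrow> real) set" where
  "colouring_points H m =
     {x. (\<forall>v\<in>pverts H. (\<forall>c\<in>{1..m}. 0 \<le> x (v, c)) \<and> (\<Sum>c\<in>{1..m}. x (v, c)) = 1) \<and>
         admissible H m (support m x)}"

definition colouring_space :: "'a pair_pre_digraph \<Rightarrow> nat \<Rightarrow> ('a \<times> nat \<Rightarrow> real) topology" where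
  "colouring_space H m = subtopology (powertop_real (pverts H \<times> {1..m})) (colouring_points H m)"

lemma topspace_colouring_space:
  "topspace (colouring_space H m) = extensional (pverts H \<times> {1..m}) \<inter> colouring_points H m"
  by (auto simp: colouring_space_def PiE_def)

lemma admissible_mono:
  assumes "admissible H m \<psi>" and "\<And>v. v \<in> pverts H \<Longrightarrow> \<phi> v \<noteq> {} \<and> \<phi> v \<subseteq> \<psi> v"
    and "parcs H \<subseteq> pverts H \<times> pverts H"
  shows "admissible H m \<phi>"
  unfolding admissible_def
proof (intro conjI ballI)
  fix v assume "v \<in> pverts H"
  then show "\<phi> v \<noteq> {}" "\<phi> v \<subseteq> {1..m}"
    using assms(1,2) by (auto simp: admissible_def)
next
  fix w assume "w \<in> pverts H"
  then obtain b where b: "b \<in> {1..m}" "\<And>v. (w, v) \<in> parcs H \<Longrightarrow> b \<notin> \<psi> v"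
    using assms(1) unfolding admissible_def by blast
  have "b \<notin> \<phi> v" if "(w, v) \<in> parcs H" for v
    using b(2)[OF that] assms(2)[of v] assms(3) that by auto
  then show "\<exists>b\<in>{1..m}. \<forall>v. (w, v) \<in> parcs H \<longrightarrow> b \<notin> \<phi> v"
    using b(1) by (intro bexI[of _ b]) simp_all
qed

lemma admissible_cong:
  assumes "\<And>v. v \<in> pverts H \<Longrightarrow> \<phi> v = \<psi> v" and "parcs H \<subseteq> pverts H \<times> pverts H"
  shows "admissible H m \<phi> \<longleftrightarrow> admissible H m \<psi>"
proof -
  have "(\<forall>v. (w, v) \<in> parcs H \<longrightarrow> b \<notin> \<phi> v) \<longleftrightarrow> (\<forall>v. (w, v) \<in> parcs H \<longrightarrow> b \<notin> \<psi> v)" for w b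
    using assms by auto
  then show ?thesis
    using assms(1) by (simp add: admissible_def)
qed

lemma support_nonempty:
  assumes "(\<Sum>c\<in>{1..m}. x (v, c)) = (1::real)"
  shows "support m x v \<noteq> {}"
proof
  assume "support m x v = {}"
  then have "(\<Sum>c\<in>{1..m}. x (v, c)) = 0"
    by (intro sum.neutral) (auto simp: support_def)
  with assms show False by simp
qed

lemma colouring_pointsI:
  assumes "\<And>v c. \<lbrakk>v \<in> pverts H; c \<in> {1..m}\<rbrakk> \<Longrightarrow> 0 \<le> x (v, c)"
    and sum: "\<And>v. v \<in> pverts H \<Longrightarrow> (\<Sum>c\<in>{1..m}. x (v, c)) = 1"
    and "admissible H m \<psi>" "\<And>v. v \<in> pverts H \<Longrightarrow> support m x v \<subseteq> \<psi> v"
    and "parcs H \<subseteq> pverts H \<times> pverts H"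
  shows "x \<in> colouring_points H m"
proof -
  have "admissible H m (support m x)"
    using assms(4) support_nonempty[OF sum] by (intro admissible_mono[OF assms(3) _ assms(5)]) simp
  then show ?thesis
    using assms(1,2) by (simp add: colouring_points_def)
qed

lemma colouring_pointsD:
  assumes "x \<in> colouring_points H m"
  shows "\<And>v c. \<lbrakk>v \<in> pverts H; c \<in> {1..m}\<rbrakk> \<Longrightarrow> 0 \<le> x (v, c)"
    and "\<And>v. v \<in> pverts H \<Longrightarrow> (\<Sum>c\<in>{1..m}. x (v, c)) = 1"
    and "admissible H m (support m x)"
  using assms unfolding colouring_points_def by simp_all

text \<open>A proper convex combination of two distributions has the union of their supports as its support.\<close>

lemma homotopic_in_colouring_space:
  assumes p: "continuous_map Y (colouring_space H m) p"
    and q: "continuous_map Y (colouring_space H m) q"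
    and adm: "\<And>y. y \<in> topspace Y \<Longrightarrow> admissible H m (\<lambda>v. support m (p y) v \<union> support m (q y) v)"
    and sub: "parcs H \<subseteq> pverts H \<times> pverts H"
  shows "homotopic_with (\<lambda>_. True) Y (colouring_space H m) p q"
  unfolding colouring_space_def
proof (rule homotopic_linear)
  show "continuous_map Y (subtopology (powertop_real (pverts H \<times> {1..m})) (colouring_points H m)) p"
    "continuous_map Y (subtopology (powertop_real (pverts H \<times> {1..m})) (colouring_points H m)) q"
    using p q by (simp_all add: colouring_space_def)
  fix y and s :: real
  assume y: "y \<in> topspace Y" and s: "0 \<le> s" "s \<le> 1"
  have py: "p y \<in> colouring_points H m" and qy: "q y \<in> colouring_points H m"
    using continuous_map_image_subset_topspace[OF p] continuous_map_image_subset_topspace[OF q] y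
    by (auto simp: topspace_colouring_space)
  let ?z = "\<lambda>i\<in>pverts H \<times> {1..m}. (1 - s) * p y i + s * q y i"
  show "?z \<in> colouring_points H m"
  proof (rule colouring_pointsI[OF _ _ adm[OF y] _ sub])
    fix v assume v: "v \<in> pverts H"
    have "(\<Sum>c\<in>{1..m}. ?z (v, c)) = (\<Sum>c\<in>{1..m}. (1 - s) * p y (v, c) + s * q y (v, c))"
      using v by (intro sum.cong) auto
    also have "\<dots> = (1 - s) * (\<Sum>c\<in>{1..m}. p y (v, c)) + s * (\<Sum>c\<in>{1..m}. q y (v, c))"
      by (simp add: sum.distrib sum_distrib_left)
    finally show "(\<Sum>c\<in>{1..m}. ?z (v, c)) = 1"
      using colouring_pointsD(2)[OF py v] colouring_pointsD(2)[OF qy v] by simp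
    show "support m ?z v \<subseteq> support m (p y) v \<union> support m (q y) v"
      using v by (auto simp: support_def)
    fix c assume "c \<in> {1..m}"
    then show "0 \<le> ?z (v, c)"
      using v s colouring_pointsD(1)[OF py v] colouring_pointsD(1)[OF qy v] by simp
  qed
qed

text \<open>For \<open>m = 1\<close> there is no such point: the boundary of a 0-dimensional simplex is empty.\<close>

definition boundary_points :: "nat \<Rightarrow> (nat \<Rightarrow> real) set" where
  "boundary_points m =
     {y. (\<forall>c\<in>{1..m}. 0 \<le> y c) \<and> (\<Sum>c\<in>{1..m}. y c) = 1 \<and> (\<exists>c\<in>{1..m}. y c = 0)}"

definition simplex_boundary :: "nat \<Rightarrow> (nat \<Rightarrow> real) topology" where
  "simplex_boundary m = subtopology (powertop_real {1..m}) (boundary_points m)"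

lemma topspace_simplex_boundary:
  "topspace (simplex_boundary m) = extensional {1..m} \<inter> boundary_points m"
  by (auto simp: simplex_boundary_def PiE_def)

lemma homotopic_in_simplex_boundary:
  assumes p: "continuous_map Y (simplex_boundary m) p"
    and q: "continuous_map Y (simplex_boundary m) q"
    and zero: "\<And>y. y \<in> topspace Y \<Longrightarrow> \<exists>c\<in>{1..m}. p y c = 0 \<and> q y c = 0"
  shows "homotopic_with (\<lambda>_. True) Y (simplex_boundary m) p q"
  unfolding simplex_boundary_def
proof (rule homotopic_linear)
  show "continuous_map Y (subtopology (powertop_real {1..m}) (boundary_points m)) p"
    "continuous_map Y (subtopology (powertop_real {1..m}) (boundary_points m)) q"
    using p q by (simp_all add: simplex_boundary_def)
  fix y and s :: real
  assume y: "y \<in> topspace Y" and s: "0 \<le> s" "s \<le> 1"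
  have py: "p y \<in> boundary_points m" and qy: "q y \<in> boundary_points m"
    using continuous_map_image_subset_topspace[OF p] continuous_map_image_subset_topspace[OF q] y
    by (auto simp: topspace_simplex_boundary)
  let ?z = "\<lambda>i\<in>{1..m}. (1 - s) * p y i + s * q y i"
  have "(\<Sum>c\<in>{1..m}. ?z c) = (\<Sum>c\<in>{1..m}. (1 - s) * p y c + s * q y c)"
    by (intro sum.cong) auto
  also have "\<dots> = (1 - s) * (\<Sum>c\<in>{1..m}. p y c) + s * (\<Sum>c\<in>{1..m}. q y c)"
    by (simp add: sum.distrib sum_distrib_left)
  also have "\<dots> = 1"
    using py qy by (simp add: boundary_points_def)
  finally have "(\<Sum>c\<in>{1..m}. ?z c) = 1" .
  then show "?z \<in> boundary_points m"
  proof -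
    obtain b where b: "b \<in> {1..m}" "p y b = 0" "q y b = 0"
      using zero[OF y] by blast
    then have "?z b = 0"
      by simp
    then show ?thesis
      using \<open>(\<Sum>c\<in>{1..m}. ?z c) = 1\<close> b(1) py qy s unfolding boundary_points_def
      by (intro CollectI conjI bexI[of _ b]) simp_all
  qed
qed

lemma continuous_map_colouring_coordinate:
  assumes "v \<in> pverts H" "c \<in> {1..m}"
  shows "continuous_map (colouring_space H m) euclideanreal (\<lambda>x. x (v, c))"
  unfolding colouring_space_def using assms
  by (intro continuous_map_from_subtopology continuous_map_product_projection[where X = "\<lambda>_. euclideanreal"]) auto

lemma continuous_map_into_colouring_space:
  "continuous_map Y (colouring_space H m) f \<longleftrightarrow>
     f ` topspace Y \<subseteq> topspace (colouring_space H m) \<and>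
     (\<forall>v\<in>pverts H. \<forall>c\<in>{1..m}. continuous_map Y euclideanreal (\<lambda>y. f y (v, c)))"
  unfolding topspace_colouring_space
  by (simp add: colouring_space_def continuous_map_in_subtopology continuous_map_componentwise
      image_subset_iff) blast

lemma continuous_map_into_simplex_boundary:
  "continuous_map Y (simplex_boundary m) f \<longleftrightarrow>
     f ` topspace Y \<subseteq> topspace (simplex_boundary m) \<and>
     (\<forall>c\<in>{1..m}. continuous_map Y euclideanreal (\<lambda>y. f y c))"
  unfolding topspace_simplex_boundary
  by (simp add: simplex_boundary_def continuous_map_in_subtopology continuous_map_componentwise
      image_subset_iff) blast

lemma continuous_map_simplex_boundary_coordinate:
  assumes "c \<in> {1..m}"
  shows "continuous_map (simplex_boundary m) euclideanreal (\<lambda>x. x c)"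
  unfolding simplex_boundary_def using assms
  by (intro continuous_map_from_subtopology continuous_map_product_projection[where X = "\<lambda>_. euclideanreal"]) auto

section \<open>The neighborhood complex of an exponential graph\<close>

text \<open>The common neighbor is chosen separately at each vertex \<open>w\<close>.\<close>

lemma neighborhood_simplices_exponential:
  assumes "parcs H \<subseteq> pverts H \<times> pverts H"
  shows "A \<in> neighborhood_simplices (exponential_graph (complete_graph m) H) \<longleftrightarrow>
     A \<subseteq> (pverts H \<rightarrow>\<^sub>E {1..m}) \<and>
     (\<forall>w\<in>pverts H. \<exists>b\<in>{1..m}. \<forall>v. (w, v) \<in> parcs H \<longrightarrow> (\<forall>f\<in>A. f v \<noteq> b))"
    (is "?L \<longleftrightarrow> ?S \<and> ?B")
proof -
  let ?P = "pverts H \<rightarrow>\<^sub>E {1..m}"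
  have adj: "(g, f) \<in> parcs (exponential_graph (complete_graph m) H) \<longleftrightarrow>
      g \<in> ?P \<and> f \<in> ?P \<and> (\<forall>w v. (w, v) \<in> parcs H \<longrightarrow> g w \<in> {1..m} \<and> f v \<in> {1..m} \<and> g w \<noteq> f v)" for f g
    by (auto simp: exponential_graph_def complete_graph_def)
  have V: "pverts (exponential_graph (complete_graph m) H) = ?P"
    by (simp add: exponential_graph_def complete_graph_def)
  show ?thesis
  proof
    assume ?L
    then obtain g where S: ?S and g: "g \<in> ?P"
      and "\<And>f. f \<in> A \<Longrightarrow> (g, f) \<in> parcs (exponential_graph (complete_graph m) H)"
      unfolding neighborhood_simplices_def V by blast
    then have ne: "g w \<noteq> f v" if "f \<in> A" "(w, v) \<in> parcs H" for f v w
      using that unfolding adj by blast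
    have ?B
    proof
      fix w assume "w \<in> pverts H"
      then have "g w \<in> {1..m}"
        using g by (rule PiE_mem[rotated])
      then show "\<exists>b\<in>{1..m}. \<forall>v. (w, v) \<in> parcs H \<longrightarrow> (\<forall>f\<in>A. f v \<noteq> b)"
        using ne by (intro bexI[of _ "g w"]) metis+
    qed
    with S show "?S \<and> ?B" by blast
  next
    assume SB: "?S \<and> ?B"
    have "\<forall>w\<in>pverts H. \<exists>b. b \<in> {1..m} \<and> (\<forall>v. (w, v) \<in> parcs H \<longrightarrow> (\<forall>f\<in>A. f v \<noteq> b))"
      using conjunct2[OF SB] unfolding Bex_def .
    then obtain g where g: "\<And>w. w \<in> pverts H \<Longrightarrow> g w \<in> {1..m}"
      "\<And>w v f. \<lbrakk>w \<in> pverts H; (w, v) \<in> parcs H; f \<in> A\<rbrakk> \<Longrightarrow> f v \<noteq> g w"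
      unfolding bchoice_iff by blast
    let ?g = "restrict g (pverts H)"
    have gP: "?g \<in> ?P"
      using g(1) by simp
    have "(?g, f) \<in> parcs (exponential_graph (complete_graph m) H)" if f: "f \<in> A" for f
      unfolding adj
    proof (intro conjI allI impI gP)
      show fP: "f \<in> ?P"
        using conjunct1[OF SB] f by (rule subsetD)
      fix w v assume wv: "(w, v) \<in> parcs H"
      then have "w \<in> pverts H" "v \<in> pverts H"
        using assms by auto
      then show "?g w \<in> {1..m}" "f v \<in> {1..m}" "?g w \<noteq> f v"
        using g(1)[of w] g(2)[OF _ wv f] PiE_mem[OF fP, of v] by auto
    qed
    then show ?L
      unfolding neighborhood_simplices_def V using conjunct1[OF SB] gP by blast
  qed
qed

lemma homotopic_in_realization:
  assumes p: "continuous_map Y (geometric_realization K) p"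
    and q: "continuous_map Y (geometric_realization K) q"
    and down: "\<And>A B. \<lbrakk>A \<in> K; B \<subseteq> A\<rbrakk> \<Longrightarrow> B \<in> K"
    and union: "\<And>y. y \<in> topspace Y \<Longrightarrow> {v \<in> \<Union>K. p y v \<noteq> 0} \<union> {v \<in> \<Union>K. q y v \<noteq> 0} \<in> K"
  shows "homotopic_with (\<lambda>_. True) Y (geometric_realization K) p q"
proof -
  let ?S = "{t. (\<forall>v\<in>\<Union>K. 0 \<le> t v) \<and> (\<Sum>v\<in>\<Union>K. t v) = 1 \<and> {v \<in> \<Union>K. t v \<noteq> 0} \<in> K}"
  show ?thesis
    unfolding geometric_realization_def
  proof (rule homotopic_linear)
    show "continuous_map Y (subtopology (powertop_real (\<Union>K)) ?S) p"
      "continuous_map Y (subtopology (powertop_real (\<Union>K)) ?S) q"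
      using p q by (simp_all add: geometric_realization_def)
    fix y and s :: real
    assume y: "y \<in> topspace Y" and s: "0 \<le> s" "s \<le> 1"
    have py: "p y \<in> ?S" and qy: "q y \<in> ?S"
      using continuous_map_image_subset_topspace[OF p] continuous_map_image_subset_topspace[OF q] y
      by (auto simp: geometric_realization_def)
    let ?z = "\<lambda>v\<in>\<Union>K. (1 - s) * p y v + s * q y v"
    have "(\<Sum>v\<in>\<Union>K. ?z v) = (\<Sum>v\<in>\<Union>K. (1 - s) * p y v + s * q y v)"
      by (intro sum.cong) simp_all
    also have "\<dots> = (1 - s) * (\<Sum>v\<in>\<Union>K. p y v) + s * (\<Sum>v\<in>\<Union>K. q y v)"
      by (simp add: sum.distrib sum_distrib_left)
    finally have sum: "(\<Sum>v\<in>\<Union>K. ?z v) = 1"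
      using py qy by simp
    have "{v \<in> \<Union>K. ?z v \<noteq> 0} \<subseteq> {v \<in> \<Union>K. p y v \<noteq> 0} \<union> {v \<in> \<Union>K. q y v \<noteq> 0}"
    proof
      fix v assume "v \<in> {v \<in> \<Union>K. ?z v \<noteq> 0}"
      then have v: "v \<in> \<Union>K" and nz: "?z v \<noteq> 0"
        by blast+
      from nz have "p y v \<noteq> 0 \<or> q y v \<noteq> 0"
        unfolding restrict_apply'[OF v] by auto
      with v show "v \<in> {v \<in> \<Union>K. p y v \<noteq> 0} \<union> {v \<in> \<Union>K. q y v \<noteq> 0}"
        by blast
    qed
    with union[OF y] have supp: "{v \<in> \<Union>K. ?z v \<noteq> 0} \<in> K"
      by (rule down)
    have "\<forall>v\<in>\<Union>K. 0 \<le> ?z v"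
      using py qy s by simp
    with sum supp show "?z \<in> ?S"
      by (intro CollectI conjI)
  qed
qed

text \<open>A point of the complex is a probability distribution on maps. The equivalence sends it to its marginal
distributions at the vertices, and marginals back to the product distribution. The
product of the marginals of \<open>t\<close> lives on the box spanned by the support of \<open>t\<close>, and this box is a
simplex because its multicolouring is that of the support. Hence both composites are
joined to the identity by straight lines.\<close>

lemma neighborhood_complex_exponential:
  assumes H: "nonisolated_graph H"
  shows "neighborhood_complex (exponential_graph (complete_graph m) H)
           homotopy_equivalent_space colouring_space H m"
proof -
  let ?V = "pverts H" and ?P = "pverts H \<rightarrow>\<^sub>E {1..m}"
  define K where "K = neighborhood_simplices (exponential_graph (complete_graph m) H)"
  define F where "F = \<Union>K"
  define S where "S = {t. (\<forall>v\<in>F. 0 \<le> t v) \<and> (\<Sum>v\<in>F. t v) = (1::real) \<and> {v \<in> F. t v \<noteq> 0} \<in> K}"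
  define N where "N = subtopology (powertop_real F) S"
  have N: "neighborhood_complex (exponential_graph (complete_graph m) H) = N"
    and N': "N = geometric_realization K"
    by (simp_all add: neighborhood_complex_def geometric_realization_def N_def S_def F_def K_def)
  have sub: "parcs H \<subseteq> ?V \<times> ?V" and finV: "finite ?V"
    using H by (simp_all add: nonisolated_graph_def)
  have K: "A \<in> K \<longleftrightarrow> A \<subseteq> ?P \<and>
     (\<forall>w\<in>?V. \<exists>b\<in>{1..m}. \<forall>v. (w, v) \<in> parcs H \<longrightarrow> (\<forall>f\<in>A. f v \<noteq> b))" for A
    unfolding K_def by (rule neighborhood_simplices_exponential[OF sub])
  have FP: "F \<subseteq> ?P"
    unfolding F_def using K by blast
  have finP: "finite ?P"
    using finV by (simp add: finite_PiE)
  have finF: "finite F"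
    using FP finP by (rule finite_subset)
  have down: "B \<in> K" if "A \<in> K" "B \<subseteq> A" for A B
    unfolding K
  proof (intro conjI ballI)
    show "B \<subseteq> ?P" using that K by blast
    fix w assume w: "w \<in> ?V"
    from bspec[OF conjunct2[OF \<open>A \<in> K\<close>[unfolded K]] w]
    obtain b where "b \<in> {1..m}" "\<forall>v. (w, v) \<in> parcs H \<longrightarrow> (\<forall>f\<in>A. f v \<noteq> b)"
      by (rule bexE)
    then show "\<exists>b\<in>{1..m}. \<forall>v. (w, v) \<in> parcs H \<longrightarrow> (\<forall>f\<in>B. f v \<noteq> b)"
      using \<open>B \<subseteq> A\<close> by (intro bexI[of _ b]) auto
  qed
  have topN: "topspace N = extensional F \<inter> S"
    by (auto simp: N_def PiE_def)
  have contN: "continuous_map Y N t \<longleftrightarrow> t ` topspace Y \<subseteq> topspace N \<and>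
      (\<forall>f\<in>F. continuous_map Y euclideanreal (\<lambda>y. t y f))" for Y :: "'z topology" and t
    unfolding topN by (simp add: N_def continuous_map_in_subtopology continuous_map_componentwise
        image_subset_iff) blast
  have coordN: "continuous_map N euclideanreal (\<lambda>t. t f)" if "f \<in> F" for f
    unfolding N_def using that
    by (intro continuous_map_from_subtopology continuous_map_product_projection[where X = "\<lambda>_. euclideanreal"]) auto
  \<comment> \<open>the marginal distributions of \<open>t\<close>, and the product distribution with given marginals\<close>
  define marg where "marg t = (\<lambda>(v, c)\<in>?V \<times> {1..m}. \<Sum>f\<in>{f \<in> F. f v = c}. t f)" for t :: "('a \<Rightarrow> nat) \<Rightarrow> real"
  define joint where "joint x = (\<lambda>f\<in>F. \<Prod>v\<in>?V. x (v, f v))" for x :: "'a \<times> nat \<Rightarrow> real"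
  have Fv: "f v \<in> {1..m}" if "f \<in> F" "v \<in> ?V" for f v
    using FP that PiE_mem by blast
  have supp_marg: "support m (marg t) v = {f v |f. f \<in> F \<and> t f \<noteq> 0}"
    if t: "t \<in> S" and v: "v \<in> ?V" for t v
  proof -
    have "(marg t (v, c) \<noteq> 0) \<longleftrightarrow> (\<exists>f\<in>F. f v = c \<and> t f \<noteq> 0)" if "c \<in> {1..m}" for c
    proof -
      have "marg t (v, c) = (\<Sum>f\<in>{f \<in> F. f v = c}. t f)"
        using v that by (simp add: marg_def)
      also have "\<dots> = 0 \<longleftrightarrow> (\<forall>f\<in>{f \<in> F. f v = c}. t f = 0)"
        using t finF by (intro sum_nonneg_eq_0_iff) (auto simp: S_def)
      finally show ?thesis by auto
    qed
    then show ?thesis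
      using Fv[OF _ v] unfolding support_def by blast
  qed
  have marg_S: "marg t \<in> colouring_points H m" if t: "t \<in> S" for t
  proof (rule colouring_pointsI[where \<psi> = "\<lambda>v. {f v |f. f \<in> F \<and> t f \<noteq> 0}"])
    fix v assume v: "v \<in> ?V"
    show "0 \<le> marg t (v, c)" if "c \<in> {1..m}" for c
      using v t that by (auto simp: marg_def S_def intro!: sum_nonneg)
    have "(\<Sum>c\<in>{1..m}. marg t (v, c)) = (\<Sum>c\<in>{1..m}. \<Sum>f\<in>{f \<in> F. f v = c}. t f)"
      using v by (intro sum.cong) (simp_all add: marg_def)
    also have "\<dots> = (\<Sum>f\<in>F. t f)"
      using finF Fv[OF _ v] by (intro sum.group) auto
    finally show "(\<Sum>c\<in>{1..m}. marg t (v, c)) = 1"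
      using t by (simp add: S_def)
    show "support m (marg t) v \<subseteq> {f v |f. f \<in> F \<and> t f \<noteq> 0}"
      using supp_marg[OF t v] by simp
  next
    have tK: "{f \<in> F. t f \<noteq> 0} \<in> K" and "(\<Sum>f\<in>F. t f) = 1"
      using t by (simp_all add: S_def)
    then obtain f0 where f0: "f0 \<in> F" "t f0 \<noteq> 0"
      by (metis (no_types, lifting) sum.neutral zero_neq_one)
    show "admissible H m (\<lambda>v. {f v |f. f \<in> F \<and> t f \<noteq> 0})"
      unfolding admissible_def
    proof (intro conjI ballI)
      fix v assume v: "v \<in> ?V"
      show "{f v |f. f \<in> F \<and> t f \<noteq> 0} \<noteq> {}"
        using f0 by blast
      show "{f v |f. f \<in> F \<and> t f \<noteq> 0} \<subseteq> {1..m}"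
        using Fv[OF _ v] by blast
    next
      fix w assume w: "w \<in> ?V"
      from bspec[OF conjunct2[OF tK[unfolded K]] w]
      obtain b where "b \<in> {1..m}" "\<forall>v. (w, v) \<in> parcs H \<longrightarrow> (\<forall>f\<in>{f \<in> F. t f \<noteq> 0}. f v \<noteq> b)"
        by (rule bexE)
      then show "\<exists>b\<in>{1..m}. \<forall>v. (w, v) \<in> parcs H \<longrightarrow> b \<notin> {f v |f. f \<in> F \<and> t f \<noteq> 0}"
        by (intro bexI[of _ b]) auto
    qed
  qed (rule sub)
  have marg: "continuous_map N (colouring_space H m) marg"
    unfolding continuous_map_into_colouring_space
  proof (intro conjI ballI)
    show "marg ` topspace N \<subseteq> topspace (colouring_space H m)"
      using marg_S by (auto simp: topN topspace_colouring_space marg_def)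
    fix v c assume "v \<in> ?V" "c \<in> {1..m}"
    then have "(\<lambda>t. marg t (v, c)) = (\<lambda>t. \<Sum>f\<in>{f \<in> F. f v = c}. t f)"
      by (simp add: marg_def)
    then show "continuous_map N euclideanreal (\<lambda>t. marg t (v, c))"
      using finF by (auto intro!: continuous_map_sum coordN)
  qed
  \<comment> \<open>the maps that choose from an admissible multicolouring form a simplex\<close>
  have box: "{f \<in> ?P. \<forall>v\<in>?V. f v \<in> \<phi> v} \<in> K" if adm: "admissible H m \<phi>" for \<phi>
    unfolding K
  proof (intro conjI ballI)
    fix w assume "w \<in> ?V"
    then obtain b where b: "b \<in> {1..m}" "\<And>v. (w, v) \<in> parcs H \<Longrightarrow> b \<notin> \<phi> v"
      using adm unfolding admissible_def by blast
    have "f v \<noteq> b" if "(w, v) \<in> parcs H" "f \<in> {f \<in> ?P. \<forall>v\<in>?V. f v \<in> \<phi> v}" for f v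
      using b(2)[OF that(1)] that sub by auto
    then show "\<exists>b\<in>{1..m}. \<forall>v. (w, v) \<in> parcs H \<longrightarrow> (\<forall>f\<in>{f \<in> ?P. \<forall>v\<in>?V. f v \<in> \<phi> v}. f v \<noteq> b)"
      using b(1) by (intro bexI[of _ b]) simp_all
  qed blast
  have prod_nz: "(\<Prod>v\<in>?V. x (v, f v)) \<noteq> 0 \<longleftrightarrow> (\<forall>v\<in>?V. f v \<in> support m x v)"
    if "f \<in> ?P" for x :: "'a \<times> nat \<Rightarrow> real" and f
    using finV PiE_mem[OF that] by (auto simp: support_def)
  have joint_nz: "joint x f \<noteq> 0 \<longleftrightarrow> (\<forall>v\<in>?V. f v \<in> support m x v)" if "f \<in> F" for x f
    using prod_nz[of f x] FP that by (auto simp: joint_def)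
  have joint_S: "joint x \<in> S" if x: "x \<in> colouring_points H m" for x
  proof -
    have adm: "admissible H m (support m x)"
      using colouring_pointsD(3)[OF x] .
    have boxF: "{f \<in> ?P. \<forall>v\<in>?V. f v \<in> support m x v} \<subseteq> F"
      using box[OF adm] unfolding F_def by blast
    have "(\<Sum>f\<in>F. joint x f) = (\<Sum>f\<in>F. \<Prod>v\<in>?V. x (v, f v))"
      by (simp add: joint_def)
    also have "\<dots> = (\<Sum>f\<in>?P. \<Prod>v\<in>?V. x (v, f v))"
    proof (rule sum.mono_neutral_left[OF finP FP], rule ballI)
      fix f assume f: "f \<in> ?P - F"
      show "(\<Prod>v\<in>?V. x (v, f v)) = 0"
      proof (rule ccontr)
        assume "(\<Prod>v\<in>?V. x (v, f v)) \<noteq> 0"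
        then have "f \<in> {f \<in> ?P. \<forall>v\<in>?V. f v \<in> support m x v}"
          using prod_nz[of f x] f by blast
        with boxF f show False by blast
      qed
    qed
    also have "\<dots> = (\<Prod>v\<in>?V. \<Sum>c\<in>{1..m}. x (v, c))"
      using finV by (simp add: prod_sum_PiE)
    also have "\<dots> = 1"
      using colouring_pointsD(2)[OF x] by simp
    finally have "(\<Sum>f\<in>F. joint x f) = 1" .
    moreover have "0 \<le> joint x f" if "f \<in> F" for f
      using that colouring_pointsD(1)[OF x] Fv[OF that] by (simp add: joint_def prod_nonneg)
    moreover have "{f \<in> F. joint x f \<noteq> 0} \<in> K"
      using box[OF adm] by (rule down) (use joint_nz FP in blast)
    ultimately show ?thesis
      by (simp add: S_def)
  qed
  have joint: "continuous_map (colouring_space H m) N joint"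
    unfolding contN
  proof (intro conjI ballI)
    show "joint ` topspace (colouring_space H m) \<subseteq> topspace N"
      using joint_S by (auto simp: topN topspace_colouring_space joint_def)
    fix f assume f: "f \<in> F"
    then have "(\<lambda>x. joint x f) = (\<lambda>x. \<Prod>v\<in>?V. x (v, f v))"
      by (simp add: joint_def)
    then show "continuous_map (colouring_space H m) euclideanreal (\<lambda>x. joint x f)"
      using finV Fv[OF f] by (auto intro!: continuous_map_prod continuous_map_colouring_coordinate)
  qed
  have 1: "homotopic_with (\<lambda>_. True) N N (joint \<circ> marg) id"
    unfolding N'
  proof (rule homotopic_in_realization)
    show "continuous_map (geometric_realization K) (geometric_realization K) (joint \<circ> marg)"
      using continuous_map_compose[OF marg joint] by (simp add: N')
    fix t assume "t \<in> topspace (geometric_realization K)"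
    then have t: "t \<in> S"
      by (simp add: topN flip: N')
    have adm: "admissible H m (support m (marg t))"
      using colouring_pointsD(3)[OF marg_S[OF t]] .
    have "{f \<in> F. (joint \<circ> marg) t f \<noteq> 0} \<union> {f \<in> F. id t f \<noteq> 0}
        \<subseteq> {f \<in> ?P. \<forall>v\<in>?V. f v \<in> support m (marg t) v}"
      using joint_nz[of _ "marg t"] supp_marg[OF t] FP by auto
    with box[OF adm] show "{f \<in> \<Union>K. (joint \<circ> marg) t f \<noteq> 0} \<union> {f \<in> \<Union>K. id t f \<noteq> 0} \<in> K"
      unfolding F_def[symmetric] by (rule down)
  qed (use down in auto)
  have 2: "homotopic_with (\<lambda>_. True) (colouring_space H m) (colouring_space H m) (marg \<circ> joint) id"
  proof (rule homotopic_in_colouring_space[OF continuous_map_compose[OF joint marg] continuous_map_id _ sub])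
    fix x assume "x \<in> topspace (colouring_space H m)"
    then have x: "x \<in> colouring_points H m"
      by (simp add: topspace_colouring_space)
    have "support m ((marg \<circ> joint) x) v \<union> support m (id x) v = support m x v" if v: "v \<in> ?V" for v
    proof -
      have "support m (marg (joint x)) v = {f v |f. f \<in> F \<and> joint x f \<noteq> 0}"
        by (rule supp_marg[OF joint_S[OF x] v])
      also have "\<dots> \<subseteq> support m x v"
        using joint_nz[of _ x] v by blast
      finally show ?thesis by auto
    qed
    then show "admissible H m (\<lambda>v. support m ((marg \<circ> joint) x) v \<union> support m (id x) v)"
      by (rule iffD2[OF admissible_cong[OF _ sub] colouring_pointsD(3)[OF x]])
  qed
  show ?thesis
    unfolding N homotopy_equivalent_space_def using marg joint 1 2 by blast
qed

section \<open>Multicolourings of a Mycielskian\<close>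

text \<open>The map \<open>r\<close> is a continuous form of \<open>R\<close> for points instead of sets. Forwards, \<open>\<alpha>\<close> applies it to
level 0; backwards, \<open>\<beta>\<close> includes the constant multicolourings. The deformation of the identity to
\<open>\<beta> \<circ> \<alpha>\<close> passes through \<open>\<gamma>\<close>, which makes level 1 constant with the value of \<open>r\<close> on level 1 and
everything else constant with the value of \<open>r\<close> on level 0. A direct segment from the identity to
\<open>\<beta> \<circ> \<alpha>\<close> need not be admissible: \<open>R\<close> of level 0 together with the colours of
level 1 can exhaust all colours, leaving none for the apex.\<close>

lemma colouring_space_mycielskian:
  assumes G: "nonisolated_graph G" and R: "colour_retraction G m R"
    and r: "continuous_map (colouring_space G m) (simplex_boundary m) r"
    and supp_r: "\<And>x. x \<in> topspace (colouring_space G m) \<Longrightarrow>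
        {c \<in> {1..m}. r x c \<noteq> 0} = R (support m x)"
  shows "colouring_space (mycielskian G) m homotopy_equivalent_space simplex_boundary m"
proof -
  let ?V = "pverts G" and ?M = "mycielskian G"
  have sub: "parcs G \<subseteq> ?V \<times> ?V" "parcs ?M \<subseteq> pverts ?M \<times> pverts ?M" and ne: "?V \<noteq> {}"
    using G nonisolated_mycielskian[OF G] by (simp_all add: nonisolated_graph_def)
  have VM: "low v \<in> pverts ?M" "mid v \<in> pverts ?M" if "v \<in> ?V" for v
    using that by (auto simp: vertices_mycielskian[OF G])
  have R_cong: "R \<phi> = R \<psi>" if "\<And>v. v \<in> ?V \<Longrightarrow> \<phi> v = \<psi> v" for \<phi> \<psi>
    using R that unfolding colour_retraction_def by (metis order.refl subset_antisym)
  have R_const: "R (\<lambda>_. A) = A" for A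
    using R unfolding colour_retraction_def by simp
  define layer where "layer l x = (\<lambda>(v, c)\<in>?V \<times> {1..m}. x (l v, c))"
    for l :: "'a \<Rightarrow> ('a \<times> nat) set" and x :: "('a \<times> nat) set \<times> nat \<Rightarrow> real"
  have layer_cont: "continuous_map (colouring_space ?M m) (colouring_space G m) (layer l)"
    and R_layer: "\<And>x. R (support m (layer l x)) = R (\<lambda>v. support m x (l v))"
    if l: "l = low \<or> l = mid" for l
  proof -
    have lv: "l v \<in> pverts ?M" if "v \<in> ?V" for v
      using l VM[OF that] by auto
    have supp: "support m (layer l x) v = support m x (l v)" if "v \<in> ?V" for v x
      using that by (auto simp: support_def layer_def)
    then show "R (support m (layer l x)) = R (\<lambda>v. support m x (l v))" for x
      by (rule R_cong)
    show "continuous_map (colouring_space ?M m) (colouring_space G m) (layer l)"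
      unfolding continuous_map_into_colouring_space
    proof (intro conjI ballI)
      show "layer l ` topspace (colouring_space ?M m) \<subseteq> topspace (colouring_space G m)"
      proof clarify
        fix x assume x: "x \<in> topspace (colouring_space ?M m)"
        then have x: "x \<in> colouring_points ?M m"
          by (simp add: topspace_colouring_space)
        have "admissible G m (\<lambda>v. support m x (l v))"
          using l retract_mycielskian(1,2)[OF G R colouring_pointsD(3)[OF x]] by auto
        then have "layer l x \<in> colouring_points G m"
          using colouring_pointsD(1,2)[OF x] lv sub supp
          by (intro colouring_pointsI[of _ _ _ "\<lambda>v. support m x (l v)"]) (auto simp: layer_def)
        then show "layer l x \<in> topspace (colouring_space G m)"
          by (simp add: topspace_colouring_space layer_def)
      qed
      fix v c assume vc: "v \<in> ?V" "c \<in> {1..m}"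
      then have "(\<lambda>x. layer l x (v, c)) = (\<lambda>x. x (l v, c))"
        by (simp add: layer_def)
      then show "continuous_map (colouring_space ?M m) euclideanreal (\<lambda>x. layer l x (v, c))"
        using continuous_map_colouring_coordinate[OF lv[OF vc(1)] vc(2)] by simp
    qed
  qed
  have rlayer_cont: "continuous_map (colouring_space ?M m) (simplex_boundary m) (\<lambda>x. r (layer l x))"
    and supp_rlayer: "\<And>x. x \<in> topspace (colouring_space ?M m) \<Longrightarrow>
        {c \<in> {1..m}. r (layer l x) c \<noteq> 0} = R (\<lambda>v. support m x (l v))"
    if l: "l = low \<or> l = mid" for l
  proof -
    show "continuous_map (colouring_space ?M m) (simplex_boundary m) (\<lambda>x. r (layer l x))"
      using continuous_map_compose[OF layer_cont[OF l] r] by (simp add: o_def)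
    show "{c \<in> {1..m}. r (layer l x) c \<noteq> 0} = R (\<lambda>v. support m x (l v))"
      if "x \<in> topspace (colouring_space ?M m)" for x
      using supp_r[of "layer l x"] R_layer[OF l] continuous_map_image_subset_topspace[OF layer_cont[OF l]] that
      by auto
  qed
  have r_pt: "r (layer l x) \<in> boundary_points m"
    if "l = low \<or> l = mid" "x \<in> topspace (colouring_space ?M m)" for l x
    using continuous_map_image_subset_topspace[OF rlayer_cont[OF that(1)]] that(2)
    by (auto simp: topspace_simplex_boundary)
  define \<alpha> where "\<alpha> = (\<lambda>x. r (layer low x))"
  define \<beta> where "\<beta> y = (\<lambda>(u, c)\<in>pverts ?M \<times> {1..m}. y c)" for y :: "nat \<Rightarrow> real"
  define \<gamma> where "\<gamma> x = (\<lambda>(u, c)\<in>pverts ?M \<times> {1..m}.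
      if u \<in> mid ` ?V then r (layer mid x) c else r (layer low x) c)" for x
  have \<alpha>: "continuous_map (colouring_space ?M m) (simplex_boundary m) \<alpha>"
    unfolding \<alpha>_def by (rule rlayer_cont) simp
  have supp_\<beta>: "support m (\<beta> y) u = {c \<in> {1..m}. y c \<noteq> 0}" if "u \<in> pverts ?M" for y u
    using that by (auto simp: support_def \<beta>_def)
  have supp_\<gamma>: "support m (\<gamma> x) u =
      (if u \<in> mid ` ?V then R (\<lambda>v. support m x (mid v)) else R (\<lambda>v. support m x (low v)))"
    if u: "u \<in> pverts ?M" and x: "x \<in> topspace (colouring_space ?M m)" for x u
    using supp_rlayer[OF _ x, of low] supp_rlayer[OF _ x, of mid] u
    by (auto simp: support_def \<gamma>_def)
  have \<beta>: "continuous_map (simplex_boundary m) (colouring_space ?M m) \<beta>"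
    unfolding continuous_map_into_colouring_space
  proof (intro conjI ballI)
    show "\<beta> ` topspace (simplex_boundary m) \<subseteq> topspace (colouring_space ?M m)"
    proof clarify
      fix y assume "y \<in> topspace (simplex_boundary m)"
      then have y: "y \<in> boundary_points m"
        by (simp add: topspace_simplex_boundary)
      let ?A = "{c \<in> {1..m}. y c \<noteq> 0}"
      have "?A \<noteq> {}"
        using support_nonempty[of "\<lambda>(u, c). y c" undefined m] y
        by (auto simp: support_def boundary_points_def)
      moreover have "\<exists>b\<in>{1..m}. b \<notin> ?A"
        using y by (auto simp: boundary_points_def)
      ultimately have "admissible ?M m (\<lambda>_. ?A)"
        unfolding admissible_def by blast
      then have "\<beta> y \<in> colouring_points ?M m"
        using y sub(2) supp_\<beta>
        by (intro colouring_pointsI[of _ _ _ "\<lambda>_. ?A"]) (auto simp: \<beta>_def boundary_points_def)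
      then show "\<beta> y \<in> topspace (colouring_space ?M m)"
        by (simp add: topspace_colouring_space \<beta>_def)
    qed
    fix u c assume uc: "u \<in> pverts ?M" "c \<in> {1..m}"
    then have "(\<lambda>y. \<beta> y (u, c)) = (\<lambda>y. y c)"
      by (simp add: \<beta>_def)
    then show "continuous_map (simplex_boundary m) euclideanreal (\<lambda>y. \<beta> y (u, c))"
      using continuous_map_simplex_boundary_coordinate[OF uc(2)] by simp
  qed
  have cases: "support m x u \<union> support m (\<gamma> x) u =
      support m x u \<union> (if u \<in> mid ` ?V then R (\<lambda>v. support m x (mid v)) else R (\<lambda>v. support m x (low v)))"
    if "u \<in> pverts ?M" "x \<in> topspace (colouring_space ?M m)" for x u
    using supp_\<gamma>[OF that] by simp
  have adm\<gamma>: "admissible ?M m (\<lambda>u. support m x u \<union> support m (\<gamma> x) u)"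
    if x: "x \<in> topspace (colouring_space ?M m)" for x
  proof -
    have "admissible ?M m (support m x)"
      using x colouring_pointsD(3) by (auto simp: topspace_colouring_space)
    from retract_mycielskian(3)[OF G R this] show ?thesis
      by (rule admissible_cong[OF cases[OF _ x] sub(2), THEN iffD2, rotated])
  qed
  have \<gamma>: "continuous_map (colouring_space ?M m) (colouring_space ?M m) \<gamma>"
    unfolding continuous_map_into_colouring_space
  proof (intro conjI ballI)
    show "\<gamma> ` topspace (colouring_space ?M m) \<subseteq> topspace (colouring_space ?M m)"
    proof clarify
      fix x assume x: "x \<in> topspace (colouring_space ?M m)"
      have "\<gamma> x \<in> colouring_points ?M m"
      proof (rule colouring_pointsI[OF _ _ adm\<gamma>[OF x] _ sub(2)])
        fix u assume u: "u \<in> pverts ?M"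
        let ?l = "if u \<in> mid ` ?V then mid else low"
        have pt: "r (layer ?l x) \<in> boundary_points m"
          by (rule r_pt[OF _ x]) simp
        have eq: "\<gamma> x (u, c) = r (layer ?l x) c" if "c \<in> {1..m}" for c
          using u that by (simp add: \<gamma>_def)
        show "0 \<le> \<gamma> x (u, c)" if "c \<in> {1..m}" for c
          using pt that unfolding eq[OF that] by (simp add: boundary_points_def)
        have "(\<Sum>c\<in>{1..m}. \<gamma> x (u, c)) = (\<Sum>c\<in>{1..m}. r (layer ?l x) c)"
          by (rule sum.cong[OF refl eq])
        then show "(\<Sum>c\<in>{1..m}. \<gamma> x (u, c)) = 1"
          using pt by (simp only: boundary_points_def mem_Collect_eq)
      qed simp
      then show "\<gamma> x \<in> topspace (colouring_space ?M m)"
        by (simp add: topspace_colouring_space \<gamma>_def)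
    qed
    fix u c assume uc: "u \<in> pverts ?M" "c \<in> {1..m}"
    then have "(\<lambda>x. \<gamma> x (u, c)) = (\<lambda>x. r (layer (if u \<in> mid ` ?V then mid else low) x) c)"
      by (auto simp: \<gamma>_def)
    moreover have "continuous_map (colouring_space ?M m) euclideanreal
        (\<lambda>x. r (layer (if u \<in> mid ` ?V then mid else low) x) c)"
      using rlayer_cont uc(2) unfolding continuous_map_into_simplex_boundary by presburger
    ultimately show "continuous_map (colouring_space ?M m) euclideanreal (\<lambda>x. \<gamma> x (u, c))"
      by simp
  qed
  have "homotopic_with (\<lambda>_. True) (colouring_space ?M m) (colouring_space ?M m) id \<gamma>"
    using \<gamma> adm\<gamma> sub(2) by (intro homotopic_in_colouring_space) auto
  moreover have "homotopic_with (\<lambda>_. True) (colouring_space ?M m) (colouring_space ?M m) \<gamma> (\<beta> \<circ> \<alpha>)"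
  proof (rule homotopic_in_colouring_space[OF \<gamma> continuous_map_compose[OF \<alpha> \<beta>] _ sub(2)])
    fix x assume x: "x \<in> topspace (colouring_space ?M m)"
    let ?A = "R (\<lambda>v. support m x (low v))" and ?B = "R (\<lambda>v. support m x (mid v))"
    have eq: "support m (\<gamma> x) u \<union> support m ((\<beta> \<circ> \<alpha>) x) u = ?A \<union> (if u \<in> mid ` ?V then ?B else {})"
      if u: "u \<in> pverts ?M" for u
      using supp_\<beta>[OF u, of "\<alpha> x"] supp_rlayer[OF _ x, of low] supp_\<gamma>[OF u x]
      by (auto simp: \<alpha>_def)
    have "admissible ?M m (support m x)"
      using x colouring_pointsD(3) by (auto simp: topspace_colouring_space)
    from retract_mycielskian(4)[OF G R this]
    show "admissible ?M m (\<lambda>u. support m (\<gamma> x) u \<union> support m ((\<beta> \<circ> \<alpha>) x) u)"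
      by (rule admissible_cong[OF eq sub(2), THEN iffD2, rotated])
  qed
  ultimately have 1: "homotopic_with (\<lambda>_. True) (colouring_space ?M m) (colouring_space ?M m) (\<beta> \<circ> \<alpha>) id"
    using homotopic_with_trans homotopic_with_sym by blast
  have 2: "homotopic_with (\<lambda>_. True) (simplex_boundary m) (simplex_boundary m) (\<alpha> \<circ> \<beta>) id"
  proof (rule homotopic_in_simplex_boundary[OF continuous_map_compose[OF \<beta> \<alpha>] continuous_map_id])
    fix y assume y: "y \<in> topspace (simplex_boundary m)"
    let ?A = "{c \<in> {1..m}. y c \<noteq> 0}"
    have \<beta>y: "\<beta> y \<in> topspace (colouring_space ?M m)"
      using continuous_map_image_subset_topspace[OF \<beta>] y by auto
    have "{c \<in> {1..m}. \<alpha> (\<beta> y) c \<noteq> 0} = R (\<lambda>v. support m (\<beta> y) (low v))"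
      using supp_rlayer[OF _ \<beta>y, of low] by (simp add: \<alpha>_def)
    also have "\<dots> = R (\<lambda>_. ?A)"
      by (rule R_cong) (simp add: supp_\<beta> VM)
    finally have "{c \<in> {1..m}. \<alpha> (\<beta> y) c \<noteq> 0} = ?A"
      by (simp add: R_const)
    moreover obtain c where "c \<in> {1..m}" "y c = 0"
      using y by (auto simp: topspace_simplex_boundary boundary_points_def)
    ultimately show "\<exists>c\<in>{1..m}. (\<alpha> \<circ> \<beta>) y c = 0 \<and> id y c = 0"
      by (intro bexI[of _ c]) auto
  qed
  show ?thesis
    unfolding homotopy_equivalent_space_def using \<alpha> \<beta> 1 2 by blast
qed

text \<open>Any neighbor of any vertex carries all of \<open>R \<phi>\<close> in the union with \<open>\<phi>\<close>.\<close>

lemma colour_retraction_proper: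
  assumes G: "nonisolated_graph G" and R: "colour_retraction G m R" and \<phi>: "admissible G m \<phi>"
  shows "\<exists>b\<in>{1..m}. b \<notin> R \<phi>"
proof -
  obtain w v where wv: "w \<in> pverts G" "(w, v) \<in> parcs G"
    using G unfolding nonisolated_graph_def by (metis all_not_in_conv)
  have "admissible G m (\<lambda>v. \<phi> v \<union> R \<phi>)"
    using R \<phi> by (simp add: colour_retraction_def)
  then have "\<exists>b\<in>{1..m}. \<forall>v. (w, v) \<in> parcs G \<longrightarrow> b \<notin> \<phi> v \<union> R \<phi>"
    using wv(1) by (simp add: admissible_def)
  then obtain b where "b \<in> {1..m}" "\<forall>v. (w, v) \<in> parcs G \<longrightarrow> b \<notin> \<phi> v \<union> R \<phi>"
    by (rule bexE)
  then show ?thesis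
    using wv(2) by (intro bexI[of _ b]) simp_all
qed

text \<open>If each base vertex independently draws a colour from its distribution, this is the expected number of
ordered pairs of base vertices that draw the colour \<open>c\<close>.\<close>

definition repeat_weight :: "nat \<Rightarrow> ((nat \<times> nat) set \<times> nat \<Rightarrow> real) \<Rightarrow> nat \<Rightarrow> real" where
  "repeat_weight n x c = (\<Sum>i\<in>{1..n}. \<Sum>j\<in>{1..n} - {i}. x (low i, c) * x (low j, c))"

lemma
  assumes n: "2 \<le> n" and x: "x \<in> colouring_points (mycielskian (complete_graph n)) m"
    and c: "c \<in> {1..m}"
  shows repeat_weight_nonneg: "0 \<le> repeat_weight n x c"
    and repeat_weight_nonzero: "repeat_weight n x c \<noteq> 0 \<longleftrightarrow> c \<in> repeated n (support m x)"
proof -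
  have nonneg: "0 \<le> x (low i, c)" if "i \<in> {1..n}" for i
    using that colouring_pointsD(1)[OF x _ c]
    by (simp add: vertices_mycielskian[OF nonisolated_complete_graph[OF n]] pverts_complete_graph)
  have inner: "0 \<le> (\<Sum>j\<in>{1..n} - {i}. x (low i, c) * x (low j, c))" if "i \<in> {1..n}" for i
    using nonneg that by (intro sum_nonneg mult_nonneg_nonneg) auto
  show "0 \<le> repeat_weight n x c"
    unfolding repeat_weight_def using inner by (rule sum_nonneg)
  have "repeat_weight n x c = 0 \<longleftrightarrow>
      (\<forall>i\<in>{1..n}. (\<Sum>j\<in>{1..n} - {i}. x (low i, c) * x (low j, c)) = 0)"
    unfolding repeat_weight_def using inner by (intro sum_nonneg_eq_0_iff) simp_all
  also have "\<dots> \<longleftrightarrow> (\<forall>i\<in>{1..n}. \<forall>j\<in>{1..n} - {i}. x (low i, c) * x (low j, c) = 0)"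
  proof (intro ball_cong refl sum_nonneg_eq_0_iff)
    fix i j assume "i \<in> {1..n}" "j \<in> {1..n} - {i}"
    then show "0 \<le> x (low i, c) * x (low j, c)"
      using nonneg by simp
  qed simp
  also have "\<dots> \<longleftrightarrow> c \<notin> repeated n (support m x)"
    using c unfolding repeated_def support_def by auto
  finally show "repeat_weight n x c \<noteq> 0 \<longleftrightarrow> c \<in> repeated n (support m x)"
    by blast
qed

text \<open>Normalizing these weights turns the set of repeated colours into a distribution that has it as its
support and depends continuously on the given distributions.\<close>

lemma repeat_retraction:
  assumes n: "2 \<le> n" and mn: "m \<le> n"
  defines "r \<equiv> \<lambda>x. \<lambda>c\<in>{1..m}. repeat_weight n x c / (\<Sum>d\<in>{1..m}. repeat_weight n x d)"
  shows "continuous_map (colouring_space (mycielskian (complete_graph n)) m) (simplex_boundary m) r"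
    and "\<And>x. x \<in> topspace (colouring_space (mycielskian (complete_graph n)) m) \<Longrightarrow>
        {c \<in> {1..m}. r x c \<noteq> 0} = repeated n (support m x)"
proof -
  let ?M = "mycielskian (complete_graph n)"
  note K = nonisolated_complete_graph[OF n]
  note R = colour_retraction_repeated[OF n mn]
  have V: "low i \<in> pverts ?M" if "i \<in> {1..n}" for i
    using that by (simp add: vertices_mycielskian[OF K] pverts_complete_graph)
  have pos: "0 < (\<Sum>d\<in>{1..m}. repeat_weight n x d)"
    and supp: "{c \<in> {1..m}. r x c \<noteq> 0} = repeated n (support m x)"
    if "x \<in> topspace (colouring_space ?M m)" for x
  proof -
    have x: "x \<in> colouring_points ?M m"
      using that by (simp add: topspace_colouring_space)
    have sub: "repeated n (support m x) \<subseteq> {1..m}"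
      unfolding repeated_def support_def by blast
    moreover have "repeated n (support m x) \<noteq> {}"
      using R colouring_pointsD(3)[OF x] by (simp add: colour_retraction_def)
    ultimately obtain c where c: "c \<in> {1..m}" "repeat_weight n x c \<noteq> 0"
      using repeat_weight_nonzero[OF n x] by blast
    then have "0 < repeat_weight n x c"
      using repeat_weight_nonneg[OF n x c(1)] by simp
    then show pos: "0 < (\<Sum>d\<in>{1..m}. repeat_weight n x d)"
      using repeat_weight_nonneg[OF n x] c(1) by (intro sum_pos2[of _ c]) simp_all
    have "r x c \<noteq> 0 \<longleftrightarrow> c \<in> repeated n (support m x)" if "c \<in> {1..m}" for c
      using repeat_weight_nonzero[OF n x that] pos that by (simp add: r_def)
    then show "{c \<in> {1..m}. r x c \<noteq> 0} = repeated n (support m x)"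
      using sub by blast
  qed
  show "\<And>x. x \<in> topspace (colouring_space ?M m) \<Longrightarrow>
        {c \<in> {1..m}. r x c \<noteq> 0} = repeated n (support m x)"
    by (rule supp)
  have cont: "continuous_map (colouring_space ?M m) euclideanreal (\<lambda>x. repeat_weight n x c)"
    if "c \<in> {1..m}" for c
    unfolding repeat_weight_def using that V
    by (intro continuous_map_sum continuous_map_real_mult continuous_map_colouring_coordinate) auto
  show "continuous_map (colouring_space ?M m) (simplex_boundary m) r"
    unfolding continuous_map_into_simplex_boundary
  proof (intro conjI ballI)
    show "r ` topspace (colouring_space ?M m) \<subseteq> topspace (simplex_boundary m)"
    proof clarify
      fix x assume x: "x \<in> topspace (colouring_space ?M m)"
      then have x': "x \<in> colouring_points ?M m"
        by (simp add: topspace_colouring_space)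
      obtain b where b: "b \<in> {1..m}" "b \<notin> repeated n (support m x)"
        using colour_retraction_proper[OF nonisolated_mycielskian[OF K] R colouring_pointsD(3)[OF x']]
        by blast
      have "(\<Sum>c\<in>{1..m}. r x c) = (\<Sum>c\<in>{1..m}. repeat_weight n x c / (\<Sum>d\<in>{1..m}. repeat_weight n x d))"
        by (intro sum.cong) (simp_all add: r_def)
      also have "\<dots> = (\<Sum>c\<in>{1..m}. repeat_weight n x c) / (\<Sum>d\<in>{1..m}. repeat_weight n x d)"
        by (rule sum_divide_distrib[symmetric])
      finally have "(\<Sum>c\<in>{1..m}. r x c) = 1"
        using pos[OF x] by simp
      moreover have "\<forall>c\<in>{1..m}. 0 \<le> r x c"
        using repeat_weight_nonneg[OF n x'] pos[OF x] by (simp add: r_def)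
      moreover have "r x b = 0"
        using supp[OF x] b by blast
      ultimately have "r x \<in> boundary_points m"
        using b(1) unfolding boundary_points_def by (intro CollectI conjI bexI[of _ b])
      then show "r x \<in> topspace (simplex_boundary m)"
        by (simp add: topspace_simplex_boundary r_def)
    qed
    fix c assume c: "c \<in> {1..m}"
    then have "(\<lambda>x. r x c) = (\<lambda>x. repeat_weight n x c / (\<Sum>d\<in>{1..m}. repeat_weight n x d))"
      by (simp add: r_def)
    moreover have "continuous_map (colouring_space ?M m) euclideanreal
        (\<lambda>x. repeat_weight n x c / (\<Sum>d\<in>{1..m}. repeat_weight n x d))"
      using pos by (intro continuous_map_real_divide continuous_map_sum cont c) force+
    ultimately show "continuous_map (colouring_space ?M m) euclideanreal (\<lambda>x. r x c)"
      by simp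
  qed
qed

section \<open>The boundary of a simplex is a sphere\<close>

lemma continuous_map_Min:
  fixes f :: "'i \<Rightarrow> 'a \<Rightarrow> real"
  assumes "finite I" "I \<noteq> {}" and "\<And>i. i \<in> I \<Longrightarrow> continuous_map X euclideanreal (f i)"
  shows "continuous_map X euclideanreal (\<lambda>x. Min ((\<lambda>i. f i x) ` I))"
  using assms
proof (induction I rule: finite_ne_induct)
  case (insert i I)
  have "(\<lambda>x. Min ((\<lambda>i. f i x) ` insert i I)) = (\<lambda>x. min (f i x) (Min ((\<lambda>i. f i x) ` I)))"
    using insert.hyps by simp
  then show ?case
    using insert by (simp add: continuous_map_real_min)
qed simp

text \<open>Modulo the constant vectors, the boundary of the simplex meets every ray exactly once. Representing
classes of vectors by those whose last coordinate vanishes, a boundary point is sent to the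
normalization of its class; in the other direction subtracting the minimum produces the
representative that is nonnegative and has a vanishing coordinate.\<close>

lemma simplex_boundary_homeomorphic_nsphere:
  "simplex_boundary (d + 2) homeomorphic_space nsphere d"
proof -
  let ?C = "{1..d + 2}" and ?m = "d + 2"
  define nrm where "nrm y = sqrt (\<Sum>i\<le>d. (y (Suc i) - y ?m)\<^sup>2)" for y :: "nat \<Rightarrow> real"
  define f where "f y i = (if i \<le> d then (y (Suc i) - y ?m) / nrm y else 0)" for y :: "nat \<Rightarrow> real" and i
  define ext where "ext x c = (if c = ?m then 0 else x (c - 1))" for x :: "nat \<Rightarrow> real" and c
  define lo where "lo x = Min (ext x ` ?C)" for x
  define g where "g x = (\<lambda>c\<in>?C. (ext x c - lo x) / (\<Sum>c\<in>?C. ext x c - lo x))" for x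
  have nrm_pos: "0 < nrm y" if y: "y \<in> boundary_points ?m" for y
  proof -
    have y0: "\<exists>c\<in>?C. y c = 0" and y1: "(\<Sum>c\<in>?C. y c) = 1"
      using y by (simp_all add: boundary_points_def)
    have "\<exists>i\<le>d. y (Suc i) - y ?m \<noteq> 0"
    proof (rule ccontr)
      assume contra: "\<not> ?thesis"
      have const: "y c = y ?m" if "c \<in> ?C" for c
      proof (cases "c = ?m")
        case False
        then have "c = Suc (c - 1)" "c - 1 \<le> d"
          using that by auto
        then show ?thesis
          using contra by (metis eq_iff_diff_eq_0)
      qed simp
      obtain b where b: "b \<in> ?C" "y b = 0"
        using y0 by blast
      have "y c = 0" if "c \<in> ?C" for c
        using const[OF that] const[OF b(1)] b(2) by metis
      then have "(\<Sum>c\<in>?C. y c) = 0"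
        by (intro sum.neutral) blast
      with y1 show False by simp
    qed
    then obtain i where i: "i \<le> d" "y (Suc i) - y ?m \<noteq> 0"
      by blast
    have "0 < (\<Sum>i\<le>d. (y (Suc i) - y ?m)\<^sup>2)"
      by (rule sum_pos2[of _ i]) (use i in simp_all)
    then show ?thesis
      by (simp add: nrm_def)
  qed
  have lo_le: "lo x \<le> ext x c" if "c \<in> ?C" for x c
    unfolding lo_def using that by simp
  have lo_att: "\<exists>c\<in>?C. ext x c = lo x" for x
  proof -
    have "lo x \<in> ext x ` ?C"
      unfolding lo_def by (rule Min_in) auto
    then show ?thesis by auto
  qed
  have tot_pos: "0 < (\<Sum>c\<in>?C. ext x c - lo x)" if x: "(\<Sum>i\<le>d. (x i)\<^sup>2) = 1" for x
  proof -
    have "\<exists>c\<in>?C. ext x c \<noteq> lo x"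
    proof (rule ccontr)
      assume contra: "\<not> ?thesis"
      then have eq: "ext x c = lo x" if "c \<in> ?C" for c
        using that by blast
      have "lo x = 0"
        using eq[of ?m] by (simp add: ext_def)
      then have "x i = 0" if "i \<le> d" for i
        using eq[of "Suc i"] that by (simp add: ext_def)
      with x show False by simp
    qed
    then obtain c where "c \<in> ?C" "ext x c \<noteq> lo x"
      by blast
    then show ?thesis
      using lo_le by (intro sum_pos2[of _ c]) (simp_all add: less_le)
  qed
  have topS: "x \<in> topspace (nsphere d) \<longleftrightarrow> (\<Sum>i\<le>d. (x i)\<^sup>2) = 1 \<and> (\<forall>i>d. x i = 0)" for x
    by (simp add: nsphere)
  have f_cont: "continuous_map (simplex_boundary ?m) (nsphere d) f"
    unfolding nsphere continuous_map_in_subtopology continuous_map_componentwise_UNIV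
  proof (intro conjI allI)
    have coord: "continuous_map (simplex_boundary ?m) euclideanreal (\<lambda>y. y c)" if "c \<in> ?C" for c
      using that by (rule continuous_map_simplex_boundary_coordinate)
    have nrm_cont: "continuous_map (simplex_boundary ?m) euclideanreal nrm"
      unfolding nrm_def by (intro continuous_intros coord) auto
    show "continuous_map (simplex_boundary ?m) euclideanreal (\<lambda>y. f y i)" for i
    proof (cases "i \<le> d")
      case True
      have "continuous_map (simplex_boundary ?m) euclideanreal (\<lambda>y. (y (Suc i) - y ?m) / nrm y)"
        using True nrm_pos
        by (intro continuous_map_real_divide continuous_map_diff coord nrm_cont)
          (auto simp: topspace_simplex_boundary less_le)
      with True show ?thesis by (simp add: f_def)
    qed (simp add: f_def)
    show "f \<in> topspace (simplex_boundary ?m) \<rightarrow> {x. (\<Sum>i\<le>d. (x i)\<^sup>2) = 1 \<and> (\<forall>i>d. x i = 0)}"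
    proof
      fix y assume "y \<in> topspace (simplex_boundary ?m)"
      then have pos: "0 < nrm y"
        using nrm_pos by (simp add: topspace_simplex_boundary)
      have "(\<Sum>i\<le>d. (f y i)\<^sup>2) = (\<Sum>i\<le>d. (y (Suc i) - y ?m)\<^sup>2) / (nrm y)\<^sup>2"
        by (simp add: f_def power_divide sum_divide_distrib)
      also have "(nrm y)\<^sup>2 = (\<Sum>i\<le>d. (y (Suc i) - y ?m)\<^sup>2)"
        by (simp add: nrm_def sum_nonneg)
      finally have "(\<Sum>i\<le>d. (f y i)\<^sup>2) = 1"
        using pos by (simp add: nrm_def)
      then show "f y \<in> {x. (\<Sum>i\<le>d. (x i)\<^sup>2) = 1 \<and> (\<forall>i>d. x i = 0)}"
        by (simp add: f_def)
    qed
  qed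
  have g_cont: "continuous_map (nsphere d) (simplex_boundary ?m) g"
    unfolding continuous_map_into_simplex_boundary
  proof (intro conjI ballI)
    show "g ` topspace (nsphere d) \<subseteq> topspace (simplex_boundary ?m)"
    proof clarify
      fix x assume "x \<in> topspace (nsphere d)"
      then have pos: "0 < (\<Sum>c\<in>?C. ext x c - lo x)"
        using tot_pos topS by blast
      have "(\<Sum>c\<in>?C. g x c) = (\<Sum>c\<in>?C. ext x c - lo x) / (\<Sum>c\<in>?C. ext x c - lo x)"
        unfolding g_def sum_divide_distrib by (intro sum.cong) simp_all
      then have "(\<Sum>c\<in>?C. g x c) = 1"
        using pos by simp
      moreover have "\<forall>c\<in>?C. 0 \<le> g x c"
      proof
        fix c assume "c \<in> ?C"
        then show "0 \<le> g x c"
          using lo_le[of c x] pos by (simp add: g_def)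
      qed
      moreover obtain c where "c \<in> ?C" "g x c = 0"
      proof -
        obtain c where "c \<in> ?C" "ext x c = lo x"
          using lo_att by blast
        then show ?thesis
          by (intro that[of c]) (simp_all add: g_def)
      qed
      ultimately have "g x \<in> boundary_points ?m"
        unfolding boundary_points_def by blast
      then show "g x \<in> topspace (simplex_boundary ?m)"
        by (simp add: topspace_simplex_boundary g_def)
    qed
    fix c assume c: "c \<in> ?C"
    have ext_cont: "continuous_map (nsphere d) euclideanreal (\<lambda>x. ext x c)" for c
      by (cases "c = ?m") (simp_all add: ext_def continuous_map_nsphere_projection)
    have lo_cont: "continuous_map (nsphere d) euclideanreal lo"
      unfolding lo_def by (rule continuous_map_Min) (simp_all add: ext_cont)
    have "continuous_map (nsphere d) euclideanreal
        (\<lambda>x. (ext x c - lo x) / (\<Sum>c\<in>?C. ext x c - lo x))"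
    proof (intro continuous_map_real_divide continuous_map_sum continuous_map_diff ext_cont lo_cont)
      fix x assume "x \<in> topspace (nsphere d)"
      then show "(\<Sum>c\<in>?C. ext x c - lo x) \<noteq> 0"
        using tot_pos[of x] topS by simp
    qed simp
    then show "continuous_map (nsphere d) euclideanreal (\<lambda>x. g x c)"
      using c by (simp add: g_def)
  qed
  have gf: "g (f y) = y" if "y \<in> topspace (simplex_boundary ?m)" for y
  proof -
    have y: "y \<in> boundary_points ?m" and "y \<in> extensional ?C"
      using that by (simp_all add: topspace_simplex_boundary)
    have pos: "0 < nrm y"
      using nrm_pos[OF y] .
    have ext_f: "ext (f y) c = (y c - y ?m) / nrm y" if "c \<in> ?C" for c
    proof (cases "c = ?m")
      case False
      then have "c - 1 \<le> d" "Suc (c - 1) = c"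
        using that by auto
      with False show ?thesis
        by (simp add: ext_def f_def)
    qed (simp add: ext_def)
    have lo_f: "lo (f y) = - y ?m / nrm y"
      unfolding lo_def
    proof (rule Min_eqI)
      obtain c where c: "c \<in> ?C" "y c = 0"
        using y by (auto simp: boundary_points_def)
      then show "- y ?m / nrm y \<in> ext (f y) ` ?C"
        using ext_f[OF c(1)] by (intro image_eqI[of _ _ c]) simp_all
      fix z assume "z \<in> ext (f y) ` ?C"
      then obtain c where c: "c \<in> ?C" "z = (y c - y ?m) / nrm y"
        using ext_f by auto
      then show "- y ?m / nrm y \<le> z"
        using y pos by (auto simp: boundary_points_def divide_simps)
    qed simp
    have diff: "ext (f y) c - lo (f y) = y c / nrm y" if "c \<in> ?C" for c
      using ext_f[OF that] by (simp add: lo_f diff_divide_distrib)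
    have "(\<Sum>c\<in>?C. ext (f y) c - lo (f y)) = (\<Sum>c\<in>?C. y c) / nrm y"
      unfolding sum_divide_distrib using diff by (rule sum.cong[OF refl])
    then have tot: "(\<Sum>c\<in>?C. ext (f y) c - lo (f y)) = 1 / nrm y"
      using y by (simp add: boundary_points_def)
    show ?thesis
    proof (rule extensionalityI[of _ ?C])
      show "g (f y) \<in> extensional ?C"
        by (simp add: g_def)
      fix c assume c: "c \<in> ?C"
      then show "g (f y) c = y c"
        unfolding g_def restrict_apply'[OF c] tot diff[OF c] using pos by simp
    qed fact
  qed
  have fg: "f (g x) = x" if x: "x \<in> topspace (nsphere d)" for x
  proof -
    define s where "s = (\<Sum>c\<in>?C. ext x c - lo x)"
    have s: "0 < s"
      using tot_pos[of x] x topS by (simp add: s_def)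
    have g_eq: "g x c = (ext x c - lo x) / s" if "c \<in> ?C" for c
      unfolding g_def restrict_apply'[OF that] s_def by (rule refl)
    have g_diff: "g x (Suc i) - g x ?m = x i / s" if "i \<le> d" for i
    proof -
      have "g x (Suc i) = (x i - lo x) / s" "g x ?m = (0 - lo x) / s"
        using g_eq[of "Suc i"] g_eq[of ?m] that by (simp_all add: ext_def)
      then show ?thesis
        by (simp add: diff_divide_distrib)
    qed
    have "(\<Sum>i\<le>d. (g x (Suc i) - g x ?m)\<^sup>2) = (\<Sum>i\<le>d. (x i)\<^sup>2 / s\<^sup>2)"
      by (intro sum.cong refl) (simp only: atMost_iff g_diff power_divide)
    also have "\<dots> = 1 / s\<^sup>2"
      using x by (simp add: topS flip: sum_divide_distrib)
    finally have nrm_g: "nrm (g x) = 1 / s"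
      using s by (simp only: nrm_def real_sqrt_divide real_sqrt_one real_sqrt_abs abs_of_pos)
    show ?thesis
    proof
      fix i
      show "f (g x) i = x i"
      proof (cases "i \<le> d")
        case True
        then have "f (g x) i = x i / s / (1 / s)"
          by (simp only: f_def if_True g_diff nrm_g)
        then show ?thesis
          using s by simp
      next
        case False
        then show ?thesis
          using x by (simp add: f_def topS)
      qed
    qed
  qed
  show ?thesis
    unfolding homeomorphic_space_def homeomorphic_maps_def using f_cont g_cont gf fg by blast
qed

section \<open>The chromatic number of the exponential graph\<close>

text \<open>If \<open>f i = f j = c\<close> for two base vertices, then a map adjacent to \<open>f\<close> cannot take the value \<open>c\<close> at any
base vertex, since each base vertex is adjacent to \<open>i\<close> or to \<open>j\<close>. So choosing a repeated colour of each
map is a proper colouring. A map that has a neighbor has a repeated colour, as its singletons form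
an admissible multicolouring.\<close>

lemma chromatic_number_exponential:
  assumes n: "2 \<le> n" and m: "1 \<le> m" and mn: "m \<le> n"
  shows "chromatic_number (exponential_graph (complete_graph m)
           (mycielskian (mycielskian (complete_graph n)))) = m"
proof -
  let ?M = "mycielskian (complete_graph n)"
  let ?H = "mycielskian ?M"
  let ?G = "exponential_graph (complete_graph m) ?H"
  note K = nonisolated_complete_graph[OF n]
  note M = nonisolated_mycielskian[OF K]
  note H = nonisolated_mycielskian[OF M]
  have VG: "pverts ?G = pverts ?H \<rightarrow>\<^sub>E {1..m}"
    by (simp add: exponential_graph_def complete_graph_def)
  have adj: "(f, g) \<in> parcs ?G \<longleftrightarrow> f \<in> pverts ?G \<and> g \<in> pverts ?G \<and>
      (\<forall>v w. (v, w) \<in> parcs ?H \<longrightarrow> f v \<in> {1..m} \<and> g w \<in> {1..m} \<and> f v \<noteq> g w)" for f g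
    by (auto simp: exponential_graph_def complete_graph_def)
  have symH: "(w, v) \<in> parcs ?H" if "(v, w) \<in> parcs ?H" for v w
    using H that by (auto simp: nonisolated_graph_def dest: symD)
  have lowV: "low v \<in> pverts ?H" if "v \<in> pverts ?M" for v
    using that by (simp add: vertices_mycielskian[OF M])
  have lowlow: "(low (low i), low (low j)) \<in> parcs ?H" if "i \<in> {1..n}" "j \<in> {1..n}" "i \<noteq> j" for i j
    using that by (auto simp: low_adjacent[OF M] low_adjacent[OF K] parcs_complete_graph)
  define rep where "rep f = repeated n (\<lambda>v. {f (low v)})" for f :: "((nat \<times> nat) set \<times> nat) set \<Rightarrow> nat"
  have ne: "rep f \<noteq> {}"
    if f: "f \<in> pverts ?G" and g: "g \<in> pverts ?G" and fg: "\<And>v w. (v, w) \<in> parcs ?H \<Longrightarrow> f v \<noteq> g w" for f g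
  proof -
    have "admissible ?M m (\<lambda>v. {f (low v)})"
      unfolding admissible_def
    proof (intro conjI ballI)
      fix v assume "v \<in> pverts ?M"
      then show "{f (low v)} \<subseteq> {1..m}"
        using f lowV PiE_mem unfolding VG by blast
    next
      fix w assume "w \<in> pverts ?M"
      then have b: "g (low w) \<in> {1..m}"
        using g lowV PiE_mem unfolding VG by blast
      have "g (low w) \<notin> {f (low v)}" if "(w, v) \<in> parcs ?M" for v
      proof -
        have "(low w, low v) \<in> parcs ?H"
          using that by (auto simp: low_adjacent[OF M])
        then show ?thesis
          using fg[OF symH] by fastforce
      qed
      then show "\<exists>b\<in>{1..m}. \<forall>v. (w, v) \<in> parcs ?M \<longrightarrow> b \<notin> {f (low v)}"
        using b by (intro bexI[of _ "g (low w)"]) simp_all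
    qed simp
    then show ?thesis
      using colour_retraction_repeated[OF n mn] by (simp add: colour_retraction_def rep_def)
  qed
  have rep_sub: "c \<in> {1..m}" if c: "c \<in> rep f" and f: "f \<in> pverts ?G" for c f
  proof -
    obtain i where i: "i \<in> {1..n}" "c = f (low (low i))"
      using c unfolding rep_def repeated_def by blast
    have "low (low i) \<in> pverts ?H"
      using i(1) by (simp add: vertices_mycielskian[OF M] vertices_mycielskian[OF K] pverts_complete_graph)
    then show ?thesis
      using i(2) f unfolding VG by auto
  qed
  \<comment> \<open>maps without repeated colours are isolated vertices, so their colour is arbitrary\<close>
  define h where "h f = (if rep f = {} then 1 else SOME c. c \<in> rep f)" for f
  have h_rep: "h f \<in> rep f" if "rep f \<noteq> {}" for f
    using that some_in_eq[of "rep f"] by (simp add: h_def)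
  have hom: "graph_hom h ?G (complete_graph m)"
    unfolding graph_hom_def
  proof (intro conjI ballI)
    have hV: "h f \<in> {1..m}" if "f \<in> pverts ?G" for f
      using h_rep[of f] rep_sub[OF _ that, of "h f"] m by (cases "rep f = {}") (simp_all add: h_def)
    then show "h f \<in> pverts (complete_graph m)" if "f \<in> pverts ?G" for f
      using that by (simp add: complete_graph_def)
    fix e assume e: "e \<in> parcs ?G"
    obtain f g where fg: "e = (f, g)"
      by (cases e)
    have f: "f \<in> pverts ?G" and g: "g \<in> pverts ?G"
      and ar: "\<And>v w. (v, w) \<in> parcs ?H \<Longrightarrow> f v \<noteq> g w"
      using e unfolding fg adj by blast+
    have "rep f \<noteq> {}"
      using ne[OF f g] ar by blast
    moreover have "rep g \<noteq> {}"
      using ne[OF g f] ar symH by metis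
    ultimately have hf: "h f \<in> rep f" and hg: "h g \<in> rep g"
      using h_rep by blast+
    obtain i j where ij: "i \<in> {1..n}" "j \<in> {1..n}" "i \<noteq> j" "h f = f (low (low i))" "h f = f (low (low j))"
      using hf unfolding rep_def repeated_def by blast
    obtain k where k: "k \<in> {1..n}" "h g = g (low (low k))"
      using hg unfolding rep_def repeated_def by blast
    have "h f \<noteq> h g"
    proof (cases "k = i")
      case True
      then show ?thesis
        using ar[OF lowlow[OF ij(2) k(1)]] ij k by simp
    next
      case False
      then show ?thesis
        using ar[OF lowlow[OF ij(1) k(1)]] ij k by simp
    qed
    then show "case e of (f, g) \<Rightarrow> (h f, h g) \<in> parcs (complete_graph m)"
      using hV[OF f] hV[OF g] by (simp add: fg complete_graph_def)
  qed
  have "m \<le> k" if k: "graph_hom h' ?G (complete_graph k)" for h' k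
  proof -
    define const where "const c = (\<lambda>v\<in>pverts ?H. c)" for c :: nat
    have cV: "const c \<in> pverts ?G" if "c \<in> {1..m}" for c
      using that unfolding VG const_def by simp
    have arc: "(const c, const d) \<in> parcs ?G" if "c \<in> {1..m}" "d \<in> {1..m}" "c \<noteq> d" for c d
    proof -
      have "const c v \<in> {1..m} \<and> const d w \<in> {1..m} \<and> const c v \<noteq> const d w" if "(v, w) \<in> parcs ?H" for v w
      proof -
        have "v \<in> pverts ?H" "w \<in> pverts ?H"
          using that H by (auto simp: nonisolated_graph_def)
        then show ?thesis
          using \<open>c \<in> {1..m}\<close> \<open>d \<in> {1..m}\<close> \<open>c \<noteq> d\<close> by (simp add: const_def)
      qed
      then show ?thesis
        unfolding adj using cV that by simp
    qed
    have "inj_on (\<lambda>c. h' (const c)) {1..m}"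
    proof (rule inj_onI, rule ccontr)
      fix c d assume cd: "c \<in> {1..m}" "d \<in> {1..m}" "h' (const c) = h' (const d)" "c \<noteq> d"
      have "\<forall>(v, w)\<in>parcs ?G. (h' v, h' w) \<in> parcs (complete_graph k)"
        using k unfolding graph_hom_def by (rule conjunct2)
      from bspec[OF this arc[OF cd(1,2,4)]] cd(3) show False
        by (simp add: complete_graph_def)
    qed
    moreover have "(\<lambda>c. h' (const c)) ` {1..m} \<subseteq> {1..k}"
      using k cV by (auto simp: graph_hom_def complete_graph_def)
    ultimately show ?thesis
      using card_inj_on_le[of _ "{1..m}" "{1..k}"] by fastforce
  qed
  with hom show ?thesis
    unfolding chromatic_number_def by (intro Least_equality) blast+
qed

section \<open>Maps into spheres of larger dimension\<close>

text \<open>An elementary version of the fact that Lipschitz maps do not raise dimension. A grid with \<open>M ^ D\<close> points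
is placed in a cube of side \<open>\<epsilon>\<close>. If the image contained all of them, then cutting the domain into
about \<open>N ^ k\<close> cells with \<open>N\<close> proportional to \<open>M\<close> would put preimages of two grid points into the same
cell, as \<open>M ^ D\<close> grows faster. With a large factor between \<open>N\<close> and \<open>M\<close> the images of a cell are too
close to each other for that.\<close>

lemma lipschitz_image_misses_point:
  fixes P :: "(nat \<Rightarrow> real) \<Rightarrow> nat \<Rightarrow> real"
  assumes kD: "k < D" and eps: "0 < \<epsilon>"
    and cube: "\<And>x i. \<lbrakk>x \<in> C; i < k\<rbrakk> \<Longrightarrow> \<bar>x i\<bar> \<le> 1"
    and lip: "\<And>x y j. \<lbrakk>x \<in> C; y \<in> C; j < D\<rbrakk> \<Longrightarrow> \<bar>P x j - P y j\<bar> \<le> L * (\<Sum>i<k. \<bar>x i - y i\<bar>)"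
  obtains u where "\<And>j. 0 \<le> u j \<and> u j \<le> \<epsilon>" "\<And>x. x \<in> C \<Longrightarrow> \<exists>j<D. P x j \<noteq> u j"
proof (rule ccontr)
  assume contra: "\<not> thesis"
  note goal = that
  \<comment> \<open>\<open>K\<close> makes the image of a cell smaller than the grid spacing, \<open>M\<close> makes the grid points outnumber the cells\<close>
  define K :: nat where "K = Suc (nat \<lceil>2 * \<bar>L\<bar> * k / \<epsilon>\<rceil>)"
  define M :: nat where "M = Suc ((2 * K) ^ k)"
  define N :: nat where "N = K * M"
  have K: "2 * \<bar>L\<bar> * k / \<epsilon> < K"
    unfolding K_def by linarith
  have "0 < K" "0 < M" "0 < N"
    by (simp_all add: K_def M_def N_def)
  let ?A = "{..<D} \<rightarrow>\<^sub>E {..<M}"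
  define u where "u a j = (if j < D then \<epsilon> * real (a j) / M else 0)" for a :: "nat \<Rightarrow> nat" and j
  have "\<exists>x\<in>C. \<forall>j<D. P x j = u a j" if a: "a \<in> ?A" for a
  proof (rule ccontr)
    assume none: "\<not> ?thesis"
    have "0 \<le> u a j \<and> u a j \<le> \<epsilon>" for j
    proof (cases "j < D")
      case True
      then have "real (a j) \<le> real M"
        using PiE_mem[OF a, of j] by simp
      then show ?thesis
        using eps \<open>0 < M\<close> True by (simp add: u_def divide_simps)
    qed (use eps in \<open>simp add: u_def\<close>)
    moreover have "\<exists>j<D. P x j \<noteq> u a j" if "x \<in> C" for x
      using none that by blast
    ultimately have thesis
      by (rule goal)
    with contra show False ..
  qed
  then have "\<forall>a\<in>?A. \<exists>x. x \<in> C \<and> (\<forall>j<D. P x j = u a j)"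
    by blast
  then obtain x where x: "\<And>a. a \<in> ?A \<Longrightarrow> x a \<in> C" "\<And>a j. \<lbrakk>a \<in> ?A; j < D\<rbrakk> \<Longrightarrow> P (x a) j = u a j"
    unfolding bchoice_iff by blast
  define cell where "cell z = (\<lambda>i\<in>{..<k}. nat \<lfloor>(z i + 1) * N / 2\<rfloor>)" for z :: "nat \<Rightarrow> real"
  have "(\<lambda>a. cell (x a)) ` ?A \<subseteq> {..<k} \<rightarrow>\<^sub>E {..N}"
  proof (intro image_subsetI PiE_I)
    fix a i assume "a \<in> ?A" "i \<in> {..<k}"
    then have "\<bar>x a i\<bar> \<le> 1"
      using cube x(1) by blast
    then have "(x a i + 1) * real N \<le> 2 * real N"
      by (intro mult_right_mono) simp_all
    then have "(x a i + 1) * N / 2 \<le> N"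
      by simp
    then have "nat \<lfloor>(x a i + 1) * N / 2\<rfloor> \<le> N"
      by linarith
    then show "cell (x a) i \<in> {..N}"
      using \<open>i \<in> {..<k}\<close> by (simp add: cell_def)
  qed (simp add: cell_def)
  then have "card ((\<lambda>a. cell (x a)) ` ?A) \<le> card ({..<k} \<rightarrow>\<^sub>E {..N})"
    by (intro card_mono finite_PiE) simp_all
  also have "\<dots> = (N + 1) ^ k"
    by (simp add: card_PiE)
  also have "\<dots> \<le> (2 * N) ^ k"
    using \<open>0 < N\<close> by (intro power_mono) simp_all
  also have "\<dots> = (2 * K) ^ k * M ^ k"
    by (simp add: N_def power_mult_distrib flip: mult.assoc)
  also have "\<dots> < M * M ^ k"
    using \<open>0 < M\<close> by (intro mult_strict_right_mono) (simp_all add: M_def)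
  also have "\<dots> = M ^ Suc k"
    by simp
  also have "\<dots> \<le> M ^ D"
    using kD \<open>0 < M\<close> by (intro power_increasing) simp_all
  also have "\<dots> = card ?A"
    by (simp add: card_PiE)
  finally have "\<not> inj_on (\<lambda>a. cell (x a)) ?A"
    by (rule pigeonhole)
  then obtain a b where a: "a \<in> ?A" and b: "b \<in> ?A" and ab: "a \<noteq> b" and same: "cell (x a) = cell (x b)"
    unfolding inj_on_def by blast
  have close: "\<bar>x a i - x b i\<bar> \<le> 2 / N" if i: "i < k" for i
  proof -
    have "0 \<le> (x a i + 1) * N / 2" "0 \<le> (x b i + 1) * N / 2"
      using cube[OF x(1)[OF a] i] cube[OF x(1)[OF b] i] by (simp_all add: abs_le_iff)
    moreover have "nat \<lfloor>(x a i + 1) * N / 2\<rfloor> = nat \<lfloor>(x b i + 1) * N / 2\<rfloor>"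
      using fun_cong[OF same, of i] i by (simp add: cell_def)
    ultimately have "\<bar>(x a i + 1) * N / 2 - (x b i + 1) * N / 2\<bar> \<le> 1"
      by linarith
    moreover have "(x a i + 1) * N / 2 - (x b i + 1) * N / 2 = (x a i - x b i) * (N / 2)"
      by (simp add: field_simps)
    ultimately have "\<bar>x a i - x b i\<bar> * (N / 2) \<le> 1"
      by (simp add: abs_mult)
    then show ?thesis
      using \<open>0 < N\<close> by (simp add: field_simps)
  qed
  obtain j where j: "j < D" "a j \<noteq> b j"
    using ab a b by (metis PiE_ext lessThan_iff)
  have "1 \<le> \<bar>real (a j) - real (b j)\<bar>"
    using j(2) by linarith
  then have "\<epsilon> / M * 1 \<le> \<epsilon> / M * \<bar>real (a j) - real (b j)\<bar>"
    using eps by (intro mult_left_mono) simp_all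
  also have "\<dots> = \<bar>u a j - u b j\<bar>"
  proof -
    have "u a j - u b j = \<epsilon> / M * (real (a j) - real (b j))"
      using j(1) by (simp add: u_def right_diff_distrib)
    then show ?thesis
      using eps by (simp add: abs_mult)
  qed
  also have "\<dots> = \<bar>P (x a) j - P (x b) j\<bar>"
    using x(2) a b j(1) by simp
  also have "\<dots> \<le> L * (\<Sum>i<k. \<bar>x a i - x b i\<bar>)"
    using lip x(1) a b j(1) by blast
  also have "\<dots> \<le> \<bar>L\<bar> * (\<Sum>i<k. \<bar>x a i - x b i\<bar>)"
    by (intro mult_right_mono sum_nonneg) simp_all
  also have "\<dots> \<le> \<bar>L\<bar> * (\<Sum>i<k. 2 / N)"
    using close by (intro mult_left_mono sum_mono) simp_all
  also have "\<dots> = (2 * \<bar>L\<bar> * k / \<epsilon>) * (\<epsilon> / N)"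
    using eps by simp
  also have "\<dots> < K * (\<epsilon> / N)"
    using K eps \<open>0 < N\<close> by (intro mult_strict_right_mono) simp_all
  also have "\<dots> = \<epsilon> / M"
    using \<open>0 < K\<close> by (simp add: N_def)
  finally show False
    by simp
qed

text \<open>The Lipschitz functions on a compact set form an algebra, to which the Stone-Weierstrass theorem
applies.\<close>

lemma lipschitz_approximation:
  fixes h :: "(nat \<Rightarrow> real) \<Rightarrow> real"
  assumes "compact C" and C0: "\<And>x i. \<lbrakk>x \<in> C; k \<le> i\<rbrakk> \<Longrightarrow> x i = 0"
    and "continuous_on C h" and "0 < \<delta>"
  obtains g L where "continuous_on C g" "\<And>x. x \<in> C \<Longrightarrow> \<bar>h x - g x\<bar> < \<delta>"
    "\<And>x y. \<lbrakk>x \<in> C; y \<in> C\<rbrakk> \<Longrightarrow> \<bar>g x - g y\<bar> \<le> L * (\<Sum>i<k. \<bar>x i - y i\<bar>)"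
proof -
  let ?d = "\<lambda>x y :: nat \<Rightarrow> real. \<Sum>i<k. \<bar>x i - y i\<bar>"
  let ?Q = "\<lambda>g. continuous_on C g \<and> (\<exists>L. \<forall>x\<in>C. \<forall>y\<in>C. \<bar>g x - g y\<bar> \<le> L * ?d x y)"
  have d0: "0 \<le> ?d x y" for x y
    by (intro sum_nonneg) simp
  have "\<exists>g. ?Q g \<and> (\<forall>x\<in>C. \<bar>h x - g x\<bar> < \<delta>)"
  proof (rule Stone_Weierstrass_HOL[OF \<open>compact C\<close> _ _ _ _ _ \<open>continuous_on C h\<close> \<open>0 < \<delta>\<close>])
    show "?Q (\<lambda>x. c)" for c
      by (auto intro: exI[of _ 0])
  next
    fix f g assume fg: "?Q f \<and> ?Q g"
    then obtain L L' where L: "\<And>x y. \<lbrakk>x \<in> C; y \<in> C\<rbrakk> \<Longrightarrow> \<bar>f x - f y\<bar> \<le> L * ?d x y"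
      and L': "\<And>x y. \<lbrakk>x \<in> C; y \<in> C\<rbrakk> \<Longrightarrow> \<bar>g x - g y\<bar> \<le> L' * ?d x y"
      by blast
    have "\<bar>f x + g x - (f y + g y)\<bar> \<le> (L + L') * ?d x y" if "x \<in> C" "y \<in> C" for x y
      using L[OF that] L'[OF that] by (simp add: distrib_right)
    then show "?Q (\<lambda>x. f x + g x)"
      using fg by (intro conjI continuous_on_add exI[of _ "L + L'"]) blast+
    have "bounded (f ` C)" "bounded (g ` C)"
      using fg \<open>compact C\<close> by (auto intro: compact_imp_bounded compact_continuous_image)
    then obtain B B' where "0 < B" "0 < B'"
      and B: "\<And>x. x \<in> C \<Longrightarrow> \<bar>f x\<bar> \<le> B" and B': "\<And>x. x \<in> C \<Longrightarrow> \<bar>g x\<bar> \<le> B'"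
      unfolding bounded_pos by auto
    have "\<bar>f x * g x - f y * g y\<bar> \<le> (B * L' + B' * L) * ?d x y" if xy: "x \<in> C" "y \<in> C" for x y
    proof -
      have "f x * g x - f y * g y = f x * (g x - g y) + g y * (f x - f y)"
        by (simp add: algebra_simps)
      then have "\<bar>f x * g x - f y * g y\<bar> \<le> \<bar>f x\<bar> * \<bar>g x - g y\<bar> + \<bar>g y\<bar> * \<bar>f x - f y\<bar>"
        by (metis abs_mult abs_triangle_ineq)
      also have "\<dots> \<le> B * (L' * ?d x y) + B' * (L * ?d x y)"
        using B[OF xy(1)] B'[OF xy(2)] L[OF xy] L'[OF xy] \<open>0 < B\<close> \<open>0 < B'\<close>
        by (intro add_mono mult_mono) simp_all
      finally show ?thesis
        by (simp add: algebra_simps)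
    qed
    then show "?Q (\<lambda>x. f x * g x)"
      using fg by (intro conjI continuous_on_mult exI[of _ "B * L' + B' * L"]) blast+
  next
    fix x y assume xy: "x \<in> C \<and> y \<in> C \<and> x \<noteq> y"
    then obtain i where i: "x i \<noteq> y i"
      by blast
    then have "i < k"
      using C0 xy by (metis not_less)
    have "\<bar>z i - z' i\<bar> \<le> 1 * ?d z z'" for z z' :: "nat \<Rightarrow> real"
      using member_le_sum[of i "{..<k}" "\<lambda>i. \<bar>z i - z' i\<bar>"] \<open>i < k\<close> by simp
    then have "?Q (\<lambda>z. z i)"
      by (intro conjI continuous_on_coordinatewise_then_product exI[of _ 1])
        (auto intro: continuous_on_subset[OF continuous_on_product_coordinates])
    then show "\<exists>f. ?Q f \<and> f x \<noteq> f y"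
      using i by (intro exI[of _ "\<lambda>z. z i"]) simp
  qed blast
  then show ?thesis
    using that by blast
qed

lemma nsphere_eq_top_of_set:
  "nsphere n = top_of_set {x. L2_set x {..n} = 1 \<and> (\<forall>i>n. x i = 0)}"
  by (simp add: nsphere euclidean_product_topology L2_set_def)

lemma unit_ball_Suc_eq_top_of_set:
  "unit_ball (Suc n) = top_of_set {x. L2_set x {..n} \<le> 1 \<and> (\<forall>i>n. x i = 0)}"
  unfolding unit_ball_def Euclidean_space_def subtopology_subtopology euclidean_product_topology
  by (rule arg_cong[where f = top_of_set])
    (auto simp: L2_set_def lessThan_Suc_atMost Suc_le_eq)

lemma continuous_on_coordinate [continuous_intros]: "continuous_on S (\<lambda>x :: nat \<Rightarrow> real. x i)"
  by (rule continuous_on_subset[OF continuous_on_product_coordinates]) simp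

lemma continuous_on_L2_set [continuous_intros]:
  fixes f :: "'a::topological_space \<Rightarrow> 'i \<Rightarrow> real"
  assumes "\<And>i. i \<in> A \<Longrightarrow> continuous_on S (\<lambda>x. f x i)"
  shows "continuous_on S (\<lambda>x. L2_set (f x) A)"
  unfolding L2_set_def using assms by (intro continuous_intros)

lemma abs_le_L2_set:
  assumes "finite A" "i \<in> A"
  shows "\<bar>x i\<bar> \<le> L2_set x A"
proof -
  have "\<bar>x i\<bar> \<le> L2_set (\<lambda>i. \<bar>x i\<bar>) A"
    using assms by (rule member_le_L2_set)
  then show ?thesis
    by (simp add: L2_set_def)
qed

lemma compact_unit_ball_set: "compact {x :: nat \<Rightarrow> real. L2_set x {..n} \<le> 1 \<and> (\<forall>i>n. x i = 0)}"
    (is "compact ?B")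
proof -
  let ?Q = "\<Pi>\<^sub>E i\<in>UNIV. if i \<le> n then {-1..1::real} else {0}"
  have "compactin (powertop_real UNIV) ?Q"
    by (subst compactin_PiE) simp
  then have "compact ?Q"
    by (simp add: euclidean_product_topology)
  moreover have "closed ?B"
  proof -
    have "closed {x :: nat \<Rightarrow> real. L2_set x {..n} \<le> 1}"
      by (intro closed_Collect_le continuous_intros)
    moreover have "closed {x :: nat \<Rightarrow> real. x i = 0}" for i
      by (intro closed_Collect_eq continuous_intros)
    ultimately have "closed ({x. L2_set x {..n} \<le> 1} \<inter> (\<Inter>i\<in>{n<..}. {x :: nat \<Rightarrow> real. x i = 0}))"
      by (intro closed_Int closed_INT) simp_all
    then show ?thesis
      by (rule back_subst[of closed]) auto
  qed
  moreover have "?B \<subseteq> ?Q"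
  proof
    fix x assume x: "x \<in> ?B"
    have "\<bar>x i\<bar> \<le> 1" if "i \<le> n" for i
      using abs_le_L2_set[of "{..n}" i x] that x by simp
    then show "x \<in> ?Q"
      using x by (auto simp: abs_le_iff)
  qed
  ultimately show ?thesis
    using compact_Int_closed[of ?Q ?B] Int_absorb1[of ?B ?Q] by simp
qed

text \<open>Extend \<open>f\<close> to a map \<open>F\<close> from the ball into Euclidean space, approximate \<open>F\<close> by a Lipschitz map \<open>g\<close>,
and choose a small vector \<open>u\<close> outside the image of \<open>g\<close>. Then \<open>g - u\<close> vanishes nowhere and is
close to \<open>F\<close>. The map \<open>E\<close> interpolates between \<open>F\<close> where its norm is at least 1, in particular on
the sphere, and \<open>g - u\<close> where the norm of \<open>F\<close> is at most 1/2; in between \<open>E\<close> is too close to \<open>F\<close> to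
vanish. Its normalization is the extension.\<close>

lemma nsphere_map_extends_to_ball:
  assumes jd: "j < d" and f: "continuous_map (nsphere j) (nsphere d) f"
  shows "\<exists>g. continuous_map (unit_ball (Suc j)) (nsphere d) g \<and> (\<forall>x\<in>topspace (nsphere j). g x = f x)"
proof -
  let ?S = "{x :: nat \<Rightarrow> real. L2_set x {..j} = 1 \<and> (\<forall>i>j. x i = 0)}"
  let ?B = "{x :: nat \<Rightarrow> real. L2_set x {..j} \<le> 1 \<and> (\<forall>i>j. x i = 0)}"
  let ?n = "\<lambda>y :: nat \<Rightarrow> real. L2_set y {..d}"
  have f_cont: "continuous_on ?S f" and f_sphere: "\<And>x. x \<in> ?S \<Longrightarrow> ?n (f x) = 1 \<and> (\<forall>i>d. f x i = 0)"
    using f unfolding nsphere_eq_top_of_set by (auto simp: image_subset_iff)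
  have SB: "?S \<subseteq> ?B" by auto
  have closedS: "closedin (top_of_set ?B) ?S"
  proof -
    have "closedin (top_of_set ?B) {x \<in> ?B. L2_set x {..j} = 1}"
      by (intro continuous_closedin_preimage_constant continuous_intros)
    then show ?thesis
      by (rule back_subst[of "closedin (top_of_set ?B)"]) auto
  qed
  have "\<exists>F. continuous_on ?B F \<and> (\<forall>x\<in>?S. F x = f x i)" for i
  proof -
    obtain F where "continuous_on ?B F" "\<And>x. x \<in> ?S \<Longrightarrow> F x = f x i"
      using continuous_on_product_then_coordinatewise[OF f_cont, of i] closedS by (rule Tietze_unbounded) blast
    then show ?thesis
      by (intro exI[of _ F]) simp
  qed
  then obtain F where F: "\<And>i. continuous_on ?B (F i) \<and> (\<forall>x\<in>?S. F i x = f x i)"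
    using choice[of "\<lambda>i F. continuous_on ?B F \<and> (\<forall>x\<in>?S. F x = f x i)"] by blast
  have F_cont: "continuous_on ?B (F i)" for i
    using F[of i] by (rule conjunct1)
  have F_ext: "F i x = f x i" if "x \<in> ?S" for i x
    using conjunct2[OF F[of i]] that by (rule bspec)
  \<comment> \<open>\<open>d + 1\<close> coordinates, each off by at most \<open>2 * \<delta>\<close>, contribute at most 1/4 to the norm\<close>
  define \<delta> where "\<delta> = 1 / (8 * real (Suc d))"
  have "0 < \<delta>"
    by (simp add: \<delta>_def)
  have B0: "x i = 0" if "x \<in> ?B" "Suc j \<le> i" for x i
    using that by auto
  let ?d = "\<lambda>x y :: nat \<Rightarrow> real. \<Sum>i<Suc j. \<bar>x i - y i\<bar>"
  have "\<exists>g. continuous_on ?B g \<and> (\<forall>x\<in>?B. \<bar>F i x - g x\<bar> < \<delta>) \<and>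
      (\<exists>L. \<forall>x\<in>?B. \<forall>y\<in>?B. \<bar>g x - g y\<bar> \<le> L * ?d x y)" for i
  proof -
    show ?thesis
    proof (rule lipschitz_approximation[of ?B "Suc j" "F i" \<delta>])
      show "compact ?B"
        by (rule compact_unit_ball_set)
      show "x i = 0" if "x \<in> ?B" "Suc j \<le> i" for x i
        using that by (rule B0)
      show "continuous_on ?B (F i)" "0 < \<delta>"
        by fact+
      fix g L
      assume "continuous_on ?B g" "\<And>x. x \<in> ?B \<Longrightarrow> \<bar>F i x - g x\<bar> < \<delta>"
        "\<And>x y. \<lbrakk>x \<in> ?B; y \<in> ?B\<rbrakk> \<Longrightarrow> \<bar>g x - g y\<bar> \<le> L * ?d x y"
      then show ?thesis
        by (intro exI[of _ g] conjI exI[of _ L]) simp_all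
    qed
  qed
  then obtain g where g: "\<And>i. continuous_on ?B (g i) \<and> (\<forall>x\<in>?B. \<bar>F i x - g i x\<bar> < \<delta>) \<and>
      (\<exists>L. \<forall>x\<in>?B. \<forall>y\<in>?B. \<bar>g i x - g i y\<bar> \<le> L * ?d x y)"
    using choice[of "\<lambda>i g. continuous_on ?B g \<and> (\<forall>x\<in>?B. \<bar>F i x - g x\<bar> < \<delta>) \<and>
      (\<exists>L. \<forall>x\<in>?B. \<forall>y\<in>?B. \<bar>g x - g y\<bar> \<le> L * ?d x y)"] by blast
  have g_cont: "continuous_on ?B (g i)" for i
    using g[of i] by (rule conjunct1)
  have g_close: "\<bar>F i x - g i x\<bar> < \<delta>" if "x \<in> ?B" for i x
    using conjunct1[OF conjunct2[OF g[of i]]] that by (rule bspec)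
  obtain L where L: "\<And>i. \<forall>x\<in>?B. \<forall>y\<in>?B. \<bar>g i x - g i y\<bar> \<le> L i * ?d x y"
    using choice[of "\<lambda>i L. \<forall>x\<in>?B. \<forall>y\<in>?B. \<bar>g i x - g i y\<bar> \<le> L * ?d x y"]
      conjunct2[OF conjunct2[OF g]] by blast
  have g_lip: "\<bar>g i x - g i y\<bar> \<le> L i * ?d x y" if "x \<in> ?B" "y \<in> ?B" for i x y
    using bspec[OF bspec[OF L[of i] that(1)] that(2)] .
  obtain u where u: "\<And>i. 0 \<le> u i \<and> u i \<le> \<delta>" "\<And>x. x \<in> ?B \<Longrightarrow> \<exists>i<Suc d. g i x \<noteq> u i"
  proof (rule lipschitz_image_misses_point[of "Suc j" "Suc d" \<delta> ?B "\<lambda>x i. g i x" "\<Sum>i\<le>d. \<bar>L i\<bar>"])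
    show "\<bar>x i\<bar> \<le> 1" if "x \<in> ?B" "i < Suc j" for x i
      using abs_le_L2_set[of "{..j}" i x] that by simp
    show "\<bar>g i x - g i y\<bar> \<le> (\<Sum>i\<le>d. \<bar>L i\<bar>) * (\<Sum>i<Suc j. \<bar>x i - y i\<bar>)"
      if "x \<in> ?B" "y \<in> ?B" "i < Suc d" for x y i
    proof -
      have "L i \<le> (\<Sum>i\<le>d. \<bar>L i\<bar>)"
        using member_le_sum[of i "{..d}" "\<lambda>i. \<bar>L i\<bar>"] that(3) by simp
      then have "L i * (\<Sum>i<Suc j. \<bar>x i - y i\<bar>) \<le> (\<Sum>i\<le>d. \<bar>L i\<bar>) * (\<Sum>i<Suc j. \<bar>x i - y i\<bar>)"
        by (intro mult_right_mono sum_nonneg) simp_all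
      with g_lip[OF that(1,2)] show ?thesis
        by (rule order.trans)
    qed
  qed (use jd \<open>0 < \<delta>\<close> in auto)
  define w where "w x = min 1 (max 0 (2 - 2 * ?n (\<lambda>i. F i x)))" for x
  define E where "E x i = F i x + w x * (g i x - u i - F i x)" for x i
  have w01: "0 \<le> w x" "w x \<le> 1" for x
    by (simp_all add: w_def)
  have E_pos: "0 < ?n (E x)" if x: "x \<in> ?B" for x
  proof (cases "?n (\<lambda>i. F i x) \<le> 1 / 2")
    case True
    then have "w x = 1"
      by (simp add: w_def)
    then have E: "E x i = g i x - u i" for i
      by (simp add: E_def)
    obtain i where i: "i \<le> d" "g i x \<noteq> u i"
      using u(2)[OF x] by (auto simp: less_Suc_eq_le)
    have "?n (E x) \<noteq> 0"
      using i by (auto simp: L2_set_eq_0_iff E)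
    then show ?thesis
      by (simp add: less_le)
  next
    case False
    have "?n (\<lambda>i. F i x) = ?n (\<lambda>i. E x i + (- w x * (g i x - u i - F i x)))"
      by (simp add: E_def)
    also have "\<dots> \<le> ?n (E x) + ?n (\<lambda>i. - w x * (g i x - u i - F i x))"
      by (rule L2_set_triangle_ineq)
    also have "?n (\<lambda>i. - w x * (g i x - u i - F i x)) \<le> (\<Sum>i\<le>d. \<bar>- w x * (g i x - u i - F i x)\<bar>)"
      by (rule L2_set_le_sum_abs)
    also have "\<dots> \<le> (\<Sum>i\<le>d. 2 * \<delta>)"
    proof (rule sum_mono)
      fix i
      have "\<bar>g i x - u i - F i x\<bar> \<le> 2 * \<delta>"
        using g_close[OF x, of i] u(1)[of i] by linarith
      then show "\<bar>- w x * (g i x - u i - F i x)\<bar> \<le> 2 * \<delta>"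
        using mult_mono[OF w01(2)[of x], of "\<bar>g i x - u i - F i x\<bar>" "2 * \<delta>"] w01[of x]
        by (simp add: abs_mult)
    qed
    also have "\<dots> = 1 / 4"
      by (simp add: \<delta>_def field_simps)
    finally show ?thesis
      using False by linarith
  qed
  have E_cont: "continuous_on ?B (\<lambda>x. E x i)" for i
  proof -
    have "continuous_on ?B w"
      unfolding w_def by (intro continuous_intros F_cont)
    then show ?thesis
      unfolding E_def by (intro continuous_intros F_cont g_cont)
  qed
  define h where "h x i = (if i \<le> d then E x i / ?n (E x) else 0)" for x i
  have "continuous_on ?B h"
  proof (intro continuous_on_coordinatewise_then_product)
    fix i
    have nE: "continuous_on ?B (\<lambda>x. ?n (E x))"
      by (intro continuous_intros E_cont)
    have "continuous_on ?B (\<lambda>x. E x i / ?n (E x))"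
      using E_pos by (intro continuous_on_divide E_cont nE) force
    then show "continuous_on ?B (\<lambda>x. h x i)"
      by (cases "i \<le> d") (simp_all add: h_def)
  qed
  moreover have "?n (h x) = 1" if x: "x \<in> ?B" for x
  proof -
    have "?n (h x) = ?n (\<lambda>i. (1 / ?n (E x)) * E x i)"
      by (intro L2_set_cong) (simp_all add: h_def)
    also have "\<dots> = (1 / ?n (E x)) * ?n (E x)"
      using E_pos[OF x] by (intro L2_set_right_distrib[symmetric]) simp
    finally show ?thesis
      using E_pos[OF x] by simp
  qed
  ultimately have "continuous_map (unit_ball (Suc j)) (nsphere d) h"
    unfolding nsphere_eq_top_of_set unit_ball_Suc_eq_top_of_set
    by (auto simp: h_def)
  moreover have "h x = f x" if "x \<in> topspace (nsphere j)" for x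
  proof -
    have x: "x \<in> ?S"
      using that by (simp add: nsphere_eq_top_of_set)
    have Ff: "(\<lambda>i. F i x) = f x"
      using F_ext[OF x] by blast
    have "w x = 0"
      using f_sphere[OF x] by (simp add: w_def Ff)
    then have "E x = f x"
      using F_ext[OF x] by (auto simp: E_def)
    then show ?thesis
      using f_sphere[OF x] by (auto simp: h_def)
  qed
  ultimately show ?thesis
    by blast
qed

section \<open>Connectivity of homotopy spheres\<close>

text \<open>The inner half of the ball carries a rescaled copy of \<open>g\<close>, the outer shell carries the homotopy.\<close>

lemma extends_to_ball_homotopic:
  assumes hom: "homotopic_with (\<lambda>_. True) (nsphere j) Y f' f"
    and g: "continuous_map (unit_ball (Suc j)) Y g" "\<And>x. x \<in> topspace (nsphere j) \<Longrightarrow> g x = f' x"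
  shows "\<exists>g. continuous_map (unit_ball (Suc j)) Y g \<and> (\<forall>x\<in>topspace (nsphere j). g x = f x)"
proof -
  let ?n = "\<lambda>x :: nat \<Rightarrow> real. L2_set x {..j}"
  let ?B = "{x :: nat \<Rightarrow> real. ?n x \<le> 1 \<and> (\<forall>i>j. x i = 0)}"
  let ?S = "{x :: nat \<Rightarrow> real. ?n x = 1 \<and> (\<forall>i>j. x i = 0)}"
  let ?T = "top_of_set {0..1::real}"
  obtain H where H: "continuous_map (prod_topology ?T (nsphere j)) Y H"
    and H0: "\<And>x. x \<in> topspace (nsphere j) \<Longrightarrow> H (0, x) = f' x"
    and H1: "\<And>x. x \<in> topspace (nsphere j) \<Longrightarrow> H (1, x) = f x"
    using hom by (subst (asm) homotopic_with) auto
  have scale: "?n (\<lambda>i. c * x i) = c * ?n x" if "0 \<le> c" for c x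
    using that by (rule L2_set_right_distrib[symmetric])
  define k where "k x = (if 1 / 2 \<le> ?n x then H (2 * ?n x - 1, \<lambda>i. (1 / ?n x) * x i) else g (\<lambda>i. 2 * x i))"
    for x :: "nat \<Rightarrow> real"
  have "continuous_map (top_of_set ?B) Y k"
    unfolding k_def
  proof (rule continuous_map_cases_le)
    show "continuous_map (top_of_set ?B) euclideanreal (\<lambda>x. 1 / 2)"
      by simp
    show "continuous_map (top_of_set ?B) euclideanreal ?n"
      by (simp, intro continuous_intros)
    let ?B1 = "?B \<inter> {x. 1 / 2 \<le> ?n x}" and ?B2 = "?B \<inter> {x. ?n x \<le> 1 / 2}"
    have eq1: "subtopology (top_of_set ?B) {x. x \<in> topspace (top_of_set ?B) \<and> 1 / 2 \<le> ?n x} = top_of_set ?B1"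
      unfolding subtopology_subtopology by (rule arg_cong[where f = top_of_set]) auto
    have eq2: "subtopology (top_of_set ?B) {x. x \<in> topspace (top_of_set ?B) \<and> ?n x \<le> 1 / 2} = top_of_set ?B2"
      unfolding subtopology_subtopology by (rule arg_cong[where f = top_of_set]) auto
    have "continuous_map (top_of_set ?B1) (prod_topology ?T (nsphere j)) (\<lambda>x. (2 * ?n x - 1, \<lambda>i. (1 / ?n x) * x i))"
    proof (intro continuous_map_pairedI)
      have "continuous_on ?B1 (\<lambda>x. 2 * ?n x - 1)"
        by (intro continuous_intros)
      then show "continuous_map (top_of_set ?B1) ?T (\<lambda>x. 2 * ?n x - 1)"
        by auto
      have "continuous_on ?B1 (\<lambda>x i. (1 / ?n x) * x i)"
        by (intro continuous_on_coordinatewise_then_product continuous_intros) auto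
      moreover have "(\<lambda>i. (1 / ?n x) * x i) \<in> ?S" if "x \<in> ?B1" for x
        using that scale[of "1 / ?n x" x] by auto
      ultimately show "continuous_map (top_of_set ?B1) (nsphere j) (\<lambda>x i. (1 / ?n x) * x i)"
        unfolding nsphere_eq_top_of_set by auto
    qed
    from continuous_map_compose[OF this H]
    show "continuous_map (subtopology (top_of_set ?B) {x. x \<in> topspace (top_of_set ?B) \<and> 1 / 2 \<le> ?n x}) Y
        (\<lambda>x. H (2 * ?n x - 1, \<lambda>i. (1 / ?n x) * x i))"
      unfolding eq1 by (simp add: o_def)
    have "continuous_map (top_of_set ?B2) (unit_ball (Suc j)) (\<lambda>x i. 2 * x i)"
    proof -
      have "continuous_on ?B2 (\<lambda>x i. 2 * x i)"
        by (intro continuous_on_coordinatewise_then_product continuous_intros)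
      then show ?thesis
        unfolding unit_ball_Suc_eq_top_of_set using scale[of 2] by auto
    qed
    from continuous_map_compose[OF this g(1)]
    show "continuous_map (subtopology (top_of_set ?B) {x. x \<in> topspace (top_of_set ?B) \<and> ?n x \<le> 1 / 2}) Y
        (\<lambda>x. g (\<lambda>i. 2 * x i))"
      unfolding eq2 by (simp add: o_def)
    fix x assume x: "x \<in> topspace (top_of_set ?B)" "1 / 2 = ?n x"
    then have "(\<lambda>i. 2 * x i) \<in> topspace (nsphere j)"
      using scale[of 2 x] by (simp add: nsphere_eq_top_of_set)
    moreover have "2 * ?n x - 1 = 0" "1 / ?n x = 2"
      unfolding x(2)[symmetric] by simp_all
    ultimately show "H (2 * ?n x - 1, \<lambda>i. (1 / ?n x) * x i) = g (\<lambda>i. 2 * x i)"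
      using H0 g(2) by simp
  qed
  moreover have "k x = f x" if "x \<in> topspace (nsphere j)" for x
    using that H1[OF that] by (simp add: k_def nsphere_eq_top_of_set)
  ultimately show ?thesis
    unfolding unit_ball_Suc_eq_top_of_set by blast
qed

lemma int_sphere_simps:
  "int_sphere (-1) = trivial_topology" "int_sphere (int j) = nsphere j"
  by (simp_all add: int_sphere_def)

lemma k_connected_homotopy_equivalent:
  assumes XY: "X homotopy_equivalent_space Y" and X: "k_connected k X"
  shows "k_connected k Y"
  unfolding k_connected_def
proof (intro allI impI)
  fix i f
  assume i: "-1 \<le> i \<and> i \<le> k" and f: "continuous_map (int_sphere i) Y f"
  obtain p q where p: "continuous_map X Y p" and q: "continuous_map Y X q"
    and pq: "homotopic_with (\<lambda>x. True) Y Y (p \<circ> q) id"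
    using XY unfolding homotopy_equivalent_space_def by blast
  have "continuous_map (int_sphere i) X (q \<circ> f)"
    by (rule continuous_map_compose[OF f q])
  then obtain g where g: "continuous_map (unit_ball (nat (i + 1))) X g"
      "\<And>x. x \<in> topspace (int_sphere i) \<Longrightarrow> g x = (q \<circ> f) x"
    using X i unfolding k_connected_def by blast
  have pg: "continuous_map (unit_ball (nat (i + 1))) Y (p \<circ> g)"
    by (rule continuous_map_compose[OF g(1) p])
  show "\<exists>g. continuous_map (unit_ball (nat (i + 1))) Y g \<and> (\<forall>x\<in>topspace (int_sphere i). g x = f x)"
  proof (cases "i = -1")
    case True
    then show ?thesis
      using pg by (intro exI[of _ "p \<circ> g"]) (simp add: int_sphere_simps)
  next
    case False
    then obtain j where j: "i = int j"
      using i nonneg_int_cases[of i] by fastforce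
    have ball: "unit_ball (nat (i + 1)) = unit_ball (Suc j)"
      by (simp add: j nat_add_distrib)
    have "homotopic_with (\<lambda>x. True) (nsphere j) Y (p \<circ> q \<circ> f) (id \<circ> f)"
      by (rule homotopic_with_compose_continuous_map_right[OF pq])
        (use f in \<open>simp_all add: j int_sphere_simps\<close>)
    then show ?thesis
      using extends_to_ball_homotopic[of j Y "p \<circ> q \<circ> f" f "p \<circ> g"] pg g(2)
      unfolding ball by (simp add: j int_sphere_simps)
  qed
qed

lemma topspace_unit_ball_0: "topspace (unit_ball 0) = {\<lambda>_. 0}"
  by (auto simp: unit_ball_def Euclidean_space_def)

text \<open>For \<open>d = -1\<close> the sphere is empty and already the point, as the ball of dimension 0, has no map
to it.\<close>

lemma k_connected_sphere:
  assumes "-1 \<le> d"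
  shows "k_connected k (int_sphere d) \<longleftrightarrow> k \<le> d - 1"
proof
  assume k: "k_connected k (int_sphere d)"
  show "k \<le> d - 1"
  proof (rule ccontr)
    assume "\<not> k \<le> d - 1"
    then have "\<exists>g. continuous_map (unit_ball (nat (d + 1))) (int_sphere d) g \<and>
        (\<forall>x\<in>topspace (int_sphere d). g x = id x)"
      using k[unfolded k_connected_def, rule_format, of d id] assms continuous_map_id[of "int_sphere d"]
      by simp
    then obtain g where g: "continuous_map (unit_ball (nat (d + 1))) (int_sphere d) g"
      "\<And>x. x \<in> topspace (int_sphere d) \<Longrightarrow> g x = x"
      by auto
    show False
    proof (cases "d = -1")
      case True
      then show False
        using continuous_map_image_subset_topspace[OF g(1)]
        by (simp add: int_sphere_simps topspace_unit_ball_0)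
    next
      case False
      then obtain j where j: "d = int j"
        using assms nonneg_int_cases[of d] by fastforce
      have g': "continuous_map (unit_ball (Suc j)) (nsphere j) g"
        using g(1) by (simp add: j int_sphere_simps nat_add_distrib)
      let ?T = "top_of_set {0..1::real}"
      let ?B = "{x :: nat \<Rightarrow> real. L2_set x {..j} \<le> 1 \<and> (\<forall>i>j. x i = 0)}"
      let ?S = "{x :: nat \<Rightarrow> real. L2_set x {..j} = 1 \<and> (\<forall>i>j. x i = 0)}"
      have "continuous_map (prod_topology ?T (nsphere j)) (unit_ball (Suc j)) (\<lambda>z i. (1 - fst z) * snd z i)"
      proof -
        have "continuous_on ({0..1} \<times> ?S) (\<lambda>z. snd z i)" for i
          by (rule continuous_on_product_then_coordinatewise[OF continuous_on_snd[OF continuous_on_id]])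
        then have "continuous_on ({0..1} \<times> ?S) (\<lambda>z i. (1 - fst z) * snd z i)"
          by (intro continuous_on_coordinatewise_then_product continuous_on_mult) (intro continuous_intros)
        moreover have "(\<lambda>i. (1 - t) * x i) \<in> ?B" if "t \<in> {0..1}" "x \<in> ?S" for t :: real and x
          using that L2_set_right_distrib[of "1 - t" x "{..j}"] by auto
        ultimately show ?thesis
          unfolding unit_ball_Suc_eq_top_of_set nsphere_eq_top_of_set
          by (auto simp: prod_topology_subtopology_eu)
      qed
      from continuous_map_compose[OF this g']
      have "homotopic_with (\<lambda>_. True) (nsphere j) (nsphere j) id (\<lambda>_. g (\<lambda>_. 0))"
        using g(2) by (subst homotopic_with) (auto intro!: exI simp: j int_sphere_simps)
      then show False
        using non_contractible_space_nsphere[of j] unfolding contractible_space_def by blast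
    qed
  qed
next
  assume k: "k \<le> d - 1"
  show "k_connected k (int_sphere d)"
    unfolding k_connected_def
  proof (intro allI impI)
    fix i f
    assume i: "-1 \<le> i \<and> i \<le> k" and f: "continuous_map (int_sphere i) (int_sphere d) f"
    obtain e where e: "d = int e"
      using i k nonneg_int_cases[of d] by fastforce
    show "\<exists>g. continuous_map (unit_ball (nat (i + 1))) (int_sphere d) g \<and>
        (\<forall>x\<in>topspace (int_sphere i). g x = f x)"
    proof (cases "i = -1")
      case True
      have "continuous_map (unit_ball 0) (nsphere e) (\<lambda>_. (\<lambda>n. if n = 0 then 1 else 0))"
        using in_topspace_nsphere[of e] by simp
      then show ?thesis
        using True by (intro exI[of _ "\<lambda>_. (\<lambda>n. if n = 0 then 1 else 0)"]) (simp add: e int_sphere_simps)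
    next
      case False
      then obtain j where j: "i = int j"
        using i nonneg_int_cases[of i] by fastforce
      have "j < e"
        using i k by (simp add: e j)
      then show ?thesis
        using nsphere_map_extends_to_ball[of j e f] f by (simp add: e j int_sphere_simps nat_add_distrib)
    qed
  qed
qed

lemma conn_homotopy_sphere:
  assumes "X homotopy_equivalent_space int_sphere d" and "-1 \<le> d"
  shows "conn X = d - 1"
proof -
  have "k_connected k X \<longleftrightarrow> k \<le> d - 1" for k
    using k_connected_homotopy_equivalent[of X "int_sphere d" k] k_connected_homotopy_equivalent[of "int_sphere d" X k]
      assms(1) homotopy_equivalent_space_sym[of X] k_connected_sphere[OF assms(2)] by blast
  then show ?thesis
    unfolding conn_def by (intro Greatest_equality) simp_all
qed

section \<open>Neighborhood complex, connectivity and chromatic number\<close>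

lemma simplex_boundary_homotopy_equivalent_sphere:
  assumes "1 \<le> m"
  shows "simplex_boundary m homotopy_equivalent_space int_sphere (int m - 2)"
proof (cases "m = 1")
  case True
  have "boundary_points 1 = {}"
    by (auto simp: boundary_points_def)
  then have "simplex_boundary 1 = trivial_topology"
    by (simp add: simplex_boundary_def)
  then show ?thesis
    using True by (simp add: int_sphere_def homotopy_equivalent_space_refl)
next
  case False
  define d where "d = m - 2"
  have m: "m = d + 2"
    using False assms by (simp add: d_def)
  show ?thesis
    using homeomorphic_imp_homotopy_equivalent_space[OF simplex_boundary_homeomorphic_nsphere[of d]]
    by (simp add: m int_sphere_def)
qed

theorem theorem1p5:
  fixes n m :: nat
  assumes "n \<ge> 2" and "1 \<le> m" and "m \<le> n"
  defines "G \<equiv> exponential_graph (complete_graph m)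
                  (mycielskian (mycielskian (complete_graph n)))"
  shows "int (chromatic_number G) = conn (neighborhood_complex G) + 3
         \<and> neighborhood_complex G homotopy_equivalent_space int_sphere (int m - 2)"
proof -
  note M = nonisolated_mycielskian[OF nonisolated_complete_graph[OF assms(1)]]
  have "neighborhood_complex G homotopy_equivalent_space
      colouring_space (mycielskian (mycielskian (complete_graph n))) m"
    unfolding G_def by (rule neighborhood_complex_exponential[OF nonisolated_mycielskian[OF M]])
  also have "\<dots> homotopy_equivalent_space simplex_boundary m"
    by (rule colouring_space_mycielskian[OF M colour_retraction_repeated[OF assms(1,3)]
          repeat_retraction[OF assms(1,3)]])
  also have "\<dots> homotopy_equivalent_space int_sphere (int m - 2)"
    using assms(2) by (rule simplex_boundary_homotopy_equivalent_sphere)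
  finally have sphere: "neighborhood_complex G homotopy_equivalent_space int_sphere (int m - 2)" .
  have "conn (neighborhood_complex G) = int m - 3"
    using conn_homotopy_sphere[OF sphere] assms(2) by simp
  moreover have "chromatic_number G = m"
    unfolding G_def using assms(1-3) by (rule chromatic_number_exponential)
  ultimately show ?thesis
    using sphere by simp
qed

end
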